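(* Let $|q|<1$ and let $f(-q)=(q;q)_\infty=\prod_{k\ge 1}(1-q^k)$. Set $$P=\frac{f(-q)f(-q^{4})}{q^{5/4}f(-q^{7})f(-q^{28})},\qquad Q=\frac{f(-q^2)^2}{q\,f(-q^{14})^2},$$ and write $X=\left(\frac{P}{Q}\right)^2+\left(\frac{Q}{P}\right)^2$ and $A=(PQ)^2+\left(\frac{49}{PQ}\right)^2$. Then $$A^2=A\left(X^9+7X^7-37X^5-77X^3+294X\right)-X^{12}-20X^{10}-86X^8-2065X^6+16317X^4-22981X^2.$$
   Context: $(a;q)_\infty=\prod_{n\ge0}(1-aq^n)$. Fractional powers of $q$ are taken consistently, e.g. writing $q=e^{2\pi i\tau}$ with $\operatorname{Im}\tau>0$ and $q^r=e^{2\pi i r\tau}$. *)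

theory Defs
  imports "HOL-Analysis.Analysis"
begin

definition qpochhammer_inf :: "complex \<Rightarrow> complex \<Rightarrow> complex" where
  "qpochhammer_inf a q = (\<Prod>n. 1 - a * q ^ n)"

text \<open>Ramanujan's one-variable theta function; the argument carries the sign, so that
  \<open>ramanujan_f (- q)\<close> is \<open>(q; q)\<^sub>\<infinity>\<close>, the product of \<open>1 - q ^ k\<close> over \<open>k \<ge> 1\<close>.\<close>

definition ramanujan_f :: "complex \<Rightarrow> complex" where
  "ramanujan_f x = qpochhammer_inf (- x) (- x)"

text \<open>The fractional power \<open>q\<^sup>r\<close>, with branch determined by the choice of \<open>\<tau>\<close> such that
  \<open>q = exp (2 * pi * \<i> * \<tau>)\<close>. It equals the principal value
  \<open>q powr r\<close> when \<open>-1/2 < Re \<tau> \<le> 1/2\<close>, but not in general.\<close>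

definition nome_power :: "complex \<Rightarrow> real \<Rightarrow> complex" where
  "nome_power \<tau> r = exp (2 * of_real pi * \<i> * of_real r * \<tau>)"

end

theory Submission
  imports Defs "HOL-Complex_Analysis.Complex_Analysis"
begin

text \<open>Write \<open>\<alpha>\<close>, \<open>\<beta>\<close> for the modular lambda function at \<open>q\<close> and \<open>q\<^sup>7\<close>. Multiplication by
  \<open>(1 + \<surd>-7) / 2\<close> on the lattice of the form \<open>a\<^sup>2 + 7 b\<^sup>2\<close> yields Guetzlaff's equation
  \<open>(\<alpha> \<beta>)\<^sup>1\<^sup>/\<^sup>8 + ((1 - \<alpha>) (1 - \<beta>))\<^sup>1\<^sup>/\<^sup>8 = 1\<close>. Let \<open>x\<close> be the first summand. Differentiating,
  with \<open>q d\<alpha>/dq = \<phi>(q)\<^sup>4 \<alpha> (1 - \<alpha>)\<close>, gives the multiplier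
  \<open>m = \<phi>(q)\<^sup>4 / \<phi>(q\<^sup>7)\<^sup>4 = 7 (\<beta> - x) / (x - \<alpha>)\<close>. In terms of \<open>t = x (1 - x)\<close> and
  \<open>v = (Q / P)\<^sup>4\<close> these facts become \<open>v + 1 / v = 4 t + 2 / t - 7\<close> and
  \<open>m = 1 + 4 t + 8 t (3 - 2 t) v\<close>, where branches are selected by the behaviour as \<open>q\<close> tends
  to 0. Since \<open>P Q = m (P / Q)\<^sup>9\<close>, eliminating \<open>t\<close> proves the theorem for small \<open>q\<close>, and
  analytic continuation in \<open>\<tau>\<close> does the rest.\<close>

subsection \<open>Infinite q-Pochhammer symbols\<close>

text \<open>No eighth root is ever extracted: x, 1 - x, v and m are explicit quotients of products
  (q^k; q^k) with k dividing 28, and x + (1 - x) = 1 is the only lattice identity joining q and q^7.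
  That identity constrains alpha and beta alone. The multiplier enters through derivatives, because
  q d/dq of alpha carries the factor phi^4; hence the need for the differential equation, which
  rests on Jacobi's series for the cube of (q; q): its square is a Wronskian of psi(q^2) and phi(q).

  The origin of v is v^6 = beta (1 - beta) / (alpha (1 - alpha)). With s = 4 t + 2 / t - 7 one finds
  v^3 + 1 / v^3 = s^3 - 3 s, the law by which v + 1 / v determines the sum of cubes. So v + 1 / v =
  s is known only up to the other two roots of a cubic, and the root can be identified only where
  leading terms in q are available.

  The final elimination is small: v + 1 / v = X^2 - 2 makes t quadratic over the rational functions
  of X, while A is linear in t. The theorem expresses A^2 by the trace and norm of A in this
  quadratic extension.\<close>

lemma convergent_prod_qpochhammer:
  fixes a q :: complex
  assumes "norm q < 1"
  shows "convergent_prod (\<lambda>n. 1 - a * q ^ n)"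
proof -
  have "summable (\<lambda>n. norm (a * q ^ n))"
    using assms by (auto simp: norm_mult norm_power intro!: summable_mult summable_geometric)
  then have "abs_convergent_prod (\<lambda>n. 1 - a * q ^ n)"
    by (simp add: abs_convergent_prod_conv_summable)
  then show ?thesis
    by (rule abs_convergent_prod_imp_convergent_prod)
qed

lemma qpochhammer_inf_LIMSEQ:
  assumes "norm q < 1"
  shows "(\<lambda>N. \<Prod>n<N. 1 - a * q ^ n) \<longlonglongrightarrow> qpochhammer_inf a q"
  unfolding qpochhammer_inf_def
  using convergent_prod_has_prod[OF convergent_prod_qpochhammer[OF assms]]
  by (rule has_prod_imp_tendsto')

lemma qpochhammer_inf_nonzero:
  assumes "norm q < 1" "\<And>n. a * q ^ n \<noteq> 1"
  shows "qpochhammer_inf a q \<noteq> 0"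
  unfolding qpochhammer_inf_def
  using assms by (intro prodinf_nonzero convergent_prod_qpochhammer) auto

lemma qpochhammer_inf_nonzero':
  assumes "norm q < 1" "norm a < 1"
  shows "qpochhammer_inf a q \<noteq> 0"
proof (rule qpochhammer_inf_nonzero[OF assms(1)])
  fix n
  have "norm q ^ n \<le> 1"
    using assms by (intro power_le_one) auto
  then have "norm a * norm q ^ n \<le> norm a * 1"
    by (intro mult_left_mono) auto
  then have "norm (a * q ^ n) \<le> norm a"
    by (simp add: norm_mult norm_power)
  then show "a * q ^ n \<noteq> 1"
    using assms by auto
qed

lemma qpochhammer_inf_square:
  assumes "norm q < 1"
  shows "qpochhammer_inf a q * qpochhammer_inf (- a) q = qpochhammer_inf (a\<^sup>2) (q\<^sup>2)"
proof (rule LIMSEQ_unique)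
  have "norm (q\<^sup>2) < 1"
    using assms by (simp add: norm_power power_less_one_iff)
  then show "(\<lambda>N. \<Prod>n<N. 1 - a\<^sup>2 * (q\<^sup>2) ^ n) \<longlonglongrightarrow> qpochhammer_inf (a\<^sup>2) (q\<^sup>2)"
    by (rule qpochhammer_inf_LIMSEQ)
  have "(1 - a * q ^ n) * (1 - (- a) * q ^ n) = 1 - a\<^sup>2 * (q\<^sup>2) ^ n" for n
    by (simp add: algebra_simps power2_eq_square power_mult_distrib)
  moreover have "(\<lambda>N. (\<Prod>n<N. 1 - a * q ^ n) * (\<Prod>n<N. 1 - (- a) * q ^ n))
    \<longlonglongrightarrow> qpochhammer_inf a q * qpochhammer_inf (- a) q"
    by (intro tendsto_mult qpochhammer_inf_LIMSEQ assms)
  ultimately show "(\<lambda>N. \<Prod>n<N. 1 - a\<^sup>2 * (q\<^sup>2) ^ n)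
    \<longlonglongrightarrow> qpochhammer_inf a q * qpochhammer_inf (- a) q"
    by (simp add: prod.distrib[symmetric])
qed

lemma qpochhammer_inf_split:
  assumes "norm q < 1"
  shows "qpochhammer_inf a q = qpochhammer_inf a (q\<^sup>2) * qpochhammer_inf (a * q) (q\<^sup>2)"
proof (rule LIMSEQ_unique)
  have q2: "norm (q\<^sup>2) < 1"
    using assms by (simp add: norm_power power_less_one_iff)
  have "filterlim (\<lambda>N::nat. 2 * N) at_top sequentially"
    by (rule filterlim_subseq) (auto simp: strict_mono_def)
  then show "(\<lambda>N. \<Prod>n<2*N. 1 - a * q ^ n) \<longlonglongrightarrow> qpochhammer_inf a q"
    by (rule filterlim_compose[OF qpochhammer_inf_LIMSEQ[OF assms]])
  have "(\<Prod>n<2*N. 1 - a * q ^ n) = (\<Prod>n<N. 1 - a * (q\<^sup>2) ^ n) * (\<Prod>n<N. 1 - a * q * (q\<^sup>2) ^ n)" for N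
    by (induction N) (simp_all add: power_mult[symmetric] mult_ac)
  moreover have "(\<lambda>N. (\<Prod>n<N. 1 - a * (q\<^sup>2) ^ n) * (\<Prod>n<N. 1 - a * q * (q\<^sup>2) ^ n))
    \<longlonglongrightarrow> qpochhammer_inf a (q\<^sup>2) * qpochhammer_inf (a * q) (q\<^sup>2)"
    by (intro tendsto_mult qpochhammer_inf_LIMSEQ q2)
  ultimately show "(\<lambda>N. \<Prod>n<2*N. 1 - a * q ^ n)
    \<longlonglongrightarrow> qpochhammer_inf a (q\<^sup>2) * qpochhammer_inf (a * q) (q\<^sup>2)"
    by simp
qed

subsection \<open>The Jacobi triple product\<close>

text \<open>The q-Pascal recursion, unlike a quotient of products, makes sense at roots of unity
  too. For \<open>k > n\<close> the truncated exponent \<open>n - k\<close> only multiplies a zero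
  coefficient.\<close>

fun gauss_binomial :: "complex \<Rightarrow> nat \<Rightarrow> nat \<Rightarrow> complex" where
  "gauss_binomial q n 0 = 1"
| "gauss_binomial q 0 (Suc k) = 0"
| "gauss_binomial q (Suc n) (Suc k) = gauss_binomial q n (Suc k) + q ^ (n - k) * gauss_binomial q n k"

lemma gauss_binomial_eq_0: "n < k \<Longrightarrow> gauss_binomial q n k = 0"
  by (induction q n k rule: gauss_binomial.induct) auto

lemma gauss_binomial_same: "gauss_binomial q n n = 1"
  by (induction n) (simp_all add: gauss_binomial_eq_0)

lemma q_binomial_theorem:
  "(\<Prod>k<n. 1 + y * q ^ k) = (\<Sum>k\<le>n. gauss_binomial q n k * q ^ (k choose 2) * y ^ k)"
proof (induction n)
  case (Suc n)
  let ?g = "\<lambda>n k. gauss_binomial q n k * q ^ (k choose 2) * y ^ k"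
  have step: "?g (Suc n) (Suc k) = ?g n (Suc k) + y * q ^ n * ?g n k" if "k \<le> n" for k
  proof -
    have "q ^ n = q ^ (n - k) * q ^ k"
      using that by (simp add: power_add[symmetric])
    then show ?thesis
      by (simp add: algebra_simps power_add numeral_2_eq_2)
  qed
  have "(\<Sum>k\<le>Suc n. ?g (Suc n) k) = 1 + (\<Sum>k\<le>n. ?g (Suc n) (Suc k))"
    by (subst sum.atMost_Suc_shift) (simp add: numeral_2_eq_2)
  also have "(\<Sum>k\<le>n. ?g (Suc n) (Suc k)) = (\<Sum>k\<le>n. ?g n (Suc k)) + y * q ^ n * (\<Sum>k\<le>n. ?g n k)"
    using step by (simp add: sum.distrib sum_distrib_left)
  also have "1 + ((\<Sum>k\<le>n. ?g n (Suc k)) + y * q ^ n * (\<Sum>k\<le>n. ?g n k)) =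
      (\<Sum>k\<le>Suc n. ?g n k) + y * q ^ n * (\<Sum>k\<le>n. ?g n k)"
    by (subst sum.atMost_Suc_shift) (simp add: numeral_2_eq_2)
  also have "(\<Sum>k\<le>Suc n. ?g n k) = (\<Sum>k\<le>n. ?g n k)"
    by (simp add: gauss_binomial_eq_0)
  also have "(\<Sum>k\<le>n. ?g n k) + y * q ^ n * (\<Sum>k\<le>n. ?g n k) = (1 + y * q ^ n) * (\<Sum>k\<le>n. ?g n k)"
    by (simp add: algebra_simps)
  finally show ?case
    by (simp add: Suc.IH mult.commute)
qed (simp add: numeral_2_eq_2)

text \<open>The quotient formula cleared of denominators. The two terms of the Pascal rule lower m
  or n by one, hence the induction on \<open>m + n\<close>; they recombine by 1 - q^(m+n) = (1 -
  q^n) + q^n (1 - q^m).\<close>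

lemma gauss_binomial_mult_prod:
  "gauss_binomial q (m + n) m * (\<Prod>k<m. 1 - q * q ^ k) * (\<Prod>k<n. 1 - q * q ^ k) =
   (\<Prod>k<m + n. 1 - q * q ^ k)"
proof (induction "m + n" arbitrary: m n)
  case (Suc l)
  show ?case
  proof (cases "m = 0 \<or> n = 0")
    case True
    then show ?thesis by (auto simp: gauss_binomial_same)
  next
    case False
    then obtain m' n' where m: "m = Suc m'" and n: "n = Suc n'"
      using not0_implies_Suc by blast
    let ?f = "\<lambda>m. \<Prod>k<m. 1 - q * q ^ k"
    have IH1: "gauss_binomial q (m' + n) m' * ?f m' * ?f n = ?f (m' + n)"
      using Suc.hyps(1)[of m' n] Suc.hyps(2) m by simp
    have IH2: "gauss_binomial q (m' + n) m * ?f m * ?f n' = ?f (m' + n)"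
      using Suc.hyps(1)[of m n'] Suc.hyps(2) m n by simp
    have "gauss_binomial q (m + n) m * ?f m * ?f n =
        (gauss_binomial q (m' + n) m * ?f m * ?f n') * (1 - q ^ n) +
        q ^ n * (gauss_binomial q (m' + n) m' * ?f m' * ?f n) * (1 - q ^ m)"
      by (simp add: m n algebra_simps)
    also have "\<dots> = ?f (m' + n) * (1 - q ^ m * q ^ n)"
      unfolding IH1 IH2 by (simp add: algebra_simps)
    also have "\<dots> = ?f (m + n)"
      by (simp add: m power_add mult_ac)
    finally show ?thesis .
  qed
qed simp

lemma tri_int: "(int n * (int n - 1)) div 2 = int (n choose 2)"
proof -
  have "int n * (int n - 1) = 2 * int (n choose 2)"
    by (induction n) (simp_all add: numeral_2_eq_2 algebra_simps)
  then show ?thesis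
    by simp
qed

lemma tri_neg_int: "(- int n * (- int n - 1)) div 2 = int (n choose 2) + int n"
proof -
  have "- int n * (- int n - 1) = int n * (int n - 1) + int n * 2"
    by (simp add: algebra_simps)
  then show ?thesis
    by (simp add: tri_int)
qed

lemma summable_power_choose_two:
  fixes c r :: real
  assumes "c > 0" "0 < r" "r < 1"
  shows "summable (\<lambda>n. c ^ n * r ^ (n choose 2))"
proof -
  have "(\<lambda>n. c * r ^ n) \<longlonglongrightarrow> c * 0"
    using assms by (intro tendsto_intros LIMSEQ_realpow_zero) auto
  then have "eventually (\<lambda>n. c * r ^ n < 1 / 2) sequentially"
    by (rule order_tendstoD) simp
  then obtain N where N: "c * r ^ n < 1 / 2" if "n \<ge> N" for n
    by (auto simp: eventually_at_top_linorder)
  show ?thesis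
  proof (rule summable_ratio_test[of "1/2" N])
    fix n assume "n \<ge> N"
    have "c ^ Suc n * r ^ (Suc n choose 2) = (c * r ^ n) * (c ^ n * r ^ (n choose 2))"
      by (simp add: numeral_2_eq_2 power_add)
    also have "\<dots> \<le> 1 / 2 * (c ^ n * r ^ (n choose 2))"
      using N[OF \<open>n \<ge> N\<close>] assms by (intro mult_right_mono) auto
    finally show "norm (c ^ Suc n * r ^ (Suc n choose 2)) \<le> 1 / 2 * norm (c ^ n * r ^ (n choose 2))"
      using assms by simp
  qed simp
qed

text \<open>At i = - n the exponent is \<open>n choose 2\<close> plus n, so the negative indices
  give the series of the nonnegative ones with |q| / |z| in place of |z|.\<close>

lemma theta_abs_summable:
  fixes z q :: complex
  assumes "norm q < 1" "q \<noteq> 0" "z \<noteq> 0"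
  shows "(\<lambda>i. norm (z powi i * q powi (i * (i - 1) div 2))) summable_on UNIV"
    (is "?f summable_on _")
proof -
  have r: "0 < norm q" "norm q < 1"
    using assms by auto
  have "(\<lambda>n. norm z ^ n * norm q ^ (n choose 2)) summable_on UNIV"
    using assms r by (intro summable_nonneg_imp_summable_on summable_power_choose_two) auto
  moreover have "?f (int n) = norm z ^ n * norm q ^ (n choose 2)" for n
    by (simp only: tri_int) (simp add: norm_mult norm_power)
  ultimately have "(\<lambda>n. ?f (int n)) summable_on UNIV"
    by simp
  then have 1: "?f summable_on range int"
    by (subst summable_on_reindex) (auto simp: o_def)
  have "(\<lambda>n. (norm q / norm z) ^ n * norm q ^ (n choose 2)) summable_on UNIV"
    using assms r by (intro summable_nonneg_imp_summable_on summable_power_choose_two) auto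
  moreover have "?f (- int n) = (norm q / norm z) ^ n * norm q ^ (n choose 2)" for n
    by (simp only: tri_neg_int of_nat_add[symmetric])
       (simp add: norm_mult norm_power power_int_minus norm_inverse norm_divide power_add power_divide field_simps del: of_nat_add)
  ultimately have "(\<lambda>n. ?f (- int n)) summable_on UNIV"
    by simp
  then have 2: "?f summable_on range (\<lambda>n. - int n)"
    by (subst summable_on_reindex) (auto simp: o_def inj_on_def)
  have "UNIV = range int \<union> range (\<lambda>n. - int n)"
    by (auto simp: image_iff) (metis int_cases2)
  then show ?thesis
    using summable_on_union[OF 1 2] by simp
qed

text \<open>This is the q-binomial theorem for 2 N factors at y = z / q^N, a shift that centres the
  summation index. The upper N factors form the first product; each lower factor 1 + z / q^(k+1) is
  z / q^(k+1) times a factor of the second product.\<close>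

lemma finite_triple_product:
  fixes z q :: complex
  assumes "q \<noteq> 0" "z \<noteq> 0"
  shows "(\<Prod>k<N. 1 + z * q ^ k) * (\<Prod>k<N. 1 + q / z * q ^ k) =
    (\<Sum>k\<le>2*N. gauss_binomial q (2*N) k *
      (z powi (int k - int N) * q powi ((int k - int N) * (int k - int N - 1) div 2)))"
proof -
  define y where "y = z / q ^ N"
  have "(\<Prod>k<N. 1 + q / z * q ^ k) * (z ^ N / q ^ (Suc N choose 2)) = (\<Prod>k<N. 1 + z / q ^ Suc k)"
    using assms by (induction N) (simp_all add: numeral_2_eq_2 power_add field_simps)
  also have "\<dots> = (\<Prod>k<N. 1 + y * q ^ k)"
  proof -
    have "(\<Prod>k<N. 1 + y * q ^ k) = (\<Prod>k<N. 1 + y * q ^ (N - Suc k))"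
      by (rule prod.nat_diff_reindex[symmetric])
    also have "\<dots> = (\<Prod>k<N. 1 + z / q ^ Suc k)"
    proof (rule prod.cong)
      fix k assume "k \<in> {..<N}"
      then have "q ^ N = q ^ (N - Suc k) * q ^ Suc k"
        by (simp only: power_add[symmetric]) simp
      then show "1 + y * q ^ (N - Suc k) = 1 + z / q ^ Suc k"
        using assms by (simp add: y_def)
    qed simp
    finally show ?thesis ..
  qed
  finally have low: "(\<Prod>k<N. 1 + y * q ^ k) = (\<Prod>k<N. 1 + q / z * q ^ k) * (z ^ N / q ^ (Suc N choose 2))" ..
  have "(\<Prod>k<N + M. 1 + y * q ^ k) = (\<Prod>k<N. 1 + y * q ^ k) * (\<Prod>k<M. 1 + z * q ^ k)" for M
    using assms by (induction M) (simp_all add: y_def power_add)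
  from this[of N] have "(\<Prod>k<2*N. 1 + y * q ^ k) = (\<Prod>k<N. 1 + y * q ^ k) * (\<Prod>k<N. 1 + z * q ^ k)"
    by (simp add: mult_2)
  then have "(\<Prod>k<N. 1 + z * q ^ k) * (\<Prod>k<N. 1 + q / z * q ^ k) =
      q ^ (Suc N choose 2) / z ^ N * (\<Prod>k<2*N. 1 + y * q ^ k)"
    using assms by (simp add: low field_simps)
  also have "\<dots> = (\<Sum>k\<le>2*N. q ^ (Suc N choose 2) / z ^ N *
      (gauss_binomial q (2*N) k * q ^ (k choose 2) * y ^ k))"
    by (simp only: q_binomial_theorem sum_distrib_left)
  also have "\<dots> = (\<Sum>k\<le>2*N. gauss_binomial q (2*N) k *
      (z powi (int k - int N) * q powi ((int k - int N) * (int k - int N - 1) div 2)))"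
  proof (rule sum.cong)
    fix k
    have "int k * (int k - 1) = 2 * int (k choose 2)"
      unfolding tri_int[symmetric] by (simp add: algebra_simps)
    moreover have "int N * (int N - 1) = 2 * int (N choose 2)"
      unfolding tri_int[symmetric] by (simp add: algebra_simps)
    ultimately have "(int k - int N) * (int k - int N - 1) =
        (int (k choose 2) + int (Suc N choose 2) - int N * int k) * 2"
      by (simp add: numeral_2_eq_2 algebra_simps)
    then have e: "(int k - int N) * (int k - int N - 1) div 2 =
        int (k choose 2) + int (Suc N choose 2) - int (N * k)"
      by simp
    have "z powi (int k - int N) * q powi ((int k - int N) * (int k - int N - 1) div 2) =
        z ^ k / z ^ N * (q ^ (k choose 2) * q ^ (Suc N choose 2) / q ^ (N * k))"
      unfolding e using assms by (simp add: power_int_diff power_int_add del: of_nat_mult of_nat_Suc binomial_Suc_Suc)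
    then show "q ^ (Suc N choose 2) / z ^ N * (gauss_binomial q (2*N) k * q ^ (k choose 2) * y ^ k) =
        gauss_binomial q (2*N) k *
          (z powi (int k - int N) * q powi ((int k - int N) * (int k - int N - 1) div 2))"
      by (simp add: y_def power_divide power_mult mult_ac)
  qed simp
  finally show ?thesis .
qed

text \<open>Provides the dominating constant for Tannery's theorem: the partial products of (q; q)
  have a nonzero limit and no zero factor, so both they and their inverses are bounded.\<close>

lemma gauss_binomial_bounded:
  fixes q :: complex
  assumes "norm q < 1"
  obtains C where "\<And>n k. k \<le> n \<Longrightarrow> norm (gauss_binomial q n k) \<le> C"
proof -
  let ?p = "\<lambda>n. \<Prod>k<n. 1 - q * q ^ k"
  have lim: "?p \<longlonglongrightarrow> qpochhammer_inf q q"
    by (rule qpochhammer_inf_LIMSEQ[OF assms])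
  have nz: "qpochhammer_inf q q \<noteq> 0"
    using assms by (intro qpochhammer_inf_nonzero')
  have "Bseq ?p"
    using lim by (intro convergent_imp_Bseq convergentI)
  then obtain B where B: "norm (?p n) \<le> B" for n
    by (auto simp: Bseq_def)
  have "(\<lambda>n. inverse (?p n)) \<longlonglongrightarrow> inverse (qpochhammer_inf q q)"
    using lim nz by (intro tendsto_intros)
  then have "Bseq (\<lambda>n. inverse (?p n))"
    by (intro convergent_imp_Bseq convergentI)
  then obtain D where D: "norm (inverse (?p n)) \<le> D" for n
    by (auto simp: Bseq_def)
  have pnz: "?p n \<noteq> 0" for n
  proof -
    have "q * q ^ k \<noteq> 1" for k
    proof
      assume "q * q ^ k = 1"
      then have "norm (q ^ Suc k) = norm (1 :: complex)"
        by (simp only: power_Suc)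
      moreover have "norm q ^ Suc k < 1"
        using assms by (subst power_less_one_iff) auto
      ultimately show False
        by (simp only: norm_power norm_one)
    qed
    then show ?thesis
      by (auto simp: prod_zero_iff)
  qed
  have B0: "B \<ge> 0" and D0: "D \<ge> 0"
    using order_trans[OF norm_ge_zero B[of 0]] order_trans[OF norm_ge_zero D[of 0]] by simp_all
  show ?thesis
  proof (rule that[of "B * (D * D)"])
    fix n k :: nat
    assume "k \<le> n"
    then have "gauss_binomial q n k * ?p k * ?p (n - k) = ?p n"
      using gauss_binomial_mult_prod[of q k "n - k"] by simp
    then have "gauss_binomial q n k = ?p n * (inverse (?p k) * inverse (?p (n - k)))"
      using pnz[of k] pnz[of "n - k"] by (simp add: field_simps)
    also have "norm \<dots> \<le> B * (D * D)"
      unfolding norm_mult using B D B0 D0 by (intro mult_mono) auto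
    finally show "norm (gauss_binomial q n k) \<le> B * (D * D)" .
  qed
qed

text \<open>All three partial products in the quotient formula tend to the same nonzero limit E,
  leaving E / (E * E). The formula is used only for N at least |i|, where \<open>nat\<close> does
  not truncate.\<close>

lemma gauss_binomial_central_LIMSEQ:
  fixes q :: complex
  assumes "norm q < 1"
  shows "(\<lambda>N. gauss_binomial q (2 * N) (nat (i + int N))) \<longlonglongrightarrow> 1 / qpochhammer_inf q q"
proof -
  let ?p = "\<lambda>n. \<Prod>k<n. 1 - q * q ^ k"
  let ?E = "qpochhammer_inf q q"
  have lim: "?p \<longlonglongrightarrow> ?E"
    by (rule qpochhammer_inf_LIMSEQ[OF assms])
  have nz: "?E \<noteq> 0"
    using assms by (intro qpochhammer_inf_nonzero')
  have f: "filterlim (\<lambda>N. nat (j + int N)) at_top sequentially" for j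
  proof (rule filterlim_at_top_mono)
    show "filterlim (\<lambda>N. N - nat \<bar>j\<bar>) at_top sequentially"
      by (rule filterlim_minus_const_nat_at_top)
  qed (auto intro!: always_eventually)
  have "filterlim (\<lambda>N::nat. 2 * N) at_top sequentially"
    by (rule filterlim_subseq) (auto simp: strict_mono_def)
  then have l1: "(\<lambda>N. ?p (2 * N)) \<longlonglongrightarrow> ?E"
    by (rule filterlim_compose[OF lim])
  have l2: "(\<lambda>N. ?p (nat (j + int N))) \<longlonglongrightarrow> ?E" for j
    by (rule filterlim_compose[OF lim f])
  have "(\<lambda>N. ?p (2 * N) / (?p (nat (i + int N)) * ?p (nat (- i + int N)))) \<longlonglongrightarrow> ?E / (?E * ?E)"
    using nz by (intro tendsto_intros l1 l2) auto
  moreover have "eventually (\<lambda>N. ?p (2 * N) / (?p (nat (i + int N)) * ?p (nat (- i + int N))) =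
      gauss_binomial q (2 * N) (nat (i + int N))) sequentially"
  proof -
    have "eventually (\<lambda>N. ?p (nat (i + int N)) \<noteq> 0) sequentially"
      "eventually (\<lambda>N. ?p (nat (- i + int N)) \<noteq> 0) sequentially"
      using nz by (intro tendsto_imp_eventually_ne[OF l2] nz)+
    moreover have "eventually (\<lambda>N. N \<ge> nat \<bar>i\<bar>) sequentially"
      by (rule eventually_ge_at_top)
    ultimately show ?thesis
    proof eventually_elim
      case (elim N)
      have "nat (i + int N) + nat (- i + int N) = 2 * N"
        using elim by linarith
      then have "gauss_binomial q (2 * N) (nat (i + int N)) * ?p (nat (i + int N)) * ?p (nat (- i + int N))
          = ?p (2 * N)"
        using gauss_binomial_mult_prod[of q "nat (i + int N)" "nat (- i + int N)"] by simp
      then show ?case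
        using elim by (simp add: field_simps)
    qed
  qed
  ultimately have "(\<lambda>N. gauss_binomial q (2 * N) (nat (i + int N))) \<longlonglongrightarrow> ?E / (?E * ?E)"
    by (rule Lim_transform_eventually)
  then show ?thesis
    using nz by simp
qed

text \<open>The weights are arbitrary because this limit is taken twice: for the theta series itself
  and for its derivative in z. Tannery's theorem concerns series over the naturals, so the integers
  are enumerated by \<open>int_decode\<close>.\<close>

lemma gauss_binomial_sum_LIMSEQ:
  fixes w :: "int \<Rightarrow> complex"
  assumes q: "norm q < 1" and w: "(\<lambda>i. norm (w i)) summable_on UNIV"
  shows "(\<lambda>N. \<Sum>k\<le>2*N. gauss_binomial q (2*N) k * w (int k - int N))
    \<longlonglongrightarrow> (\<Sum>\<^sub>\<infinity>i. w i) / qpochhammer_inf q q"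
proof -
  obtain C where C: "\<And>n k. k \<le> n \<Longrightarrow> norm (gauss_binomial q n k) \<le> C"
    using gauss_binomial_bounded[OF q] by blast
  have C0: "C \<ge> 0"
    using order_trans[OF norm_ge_zero C[of 0 0]] by simp
  define g where "g N i = (if \<bar>i\<bar> \<le> int N then gauss_binomial q (2*N) (nat (i + int N)) * w i else 0)" for N i
  have bij: "bij int_decode"
    by (rule bij_int_decode)
  have "(\<lambda>k. norm (w (int_decode k))) summable_on UNIV"
    using w summable_on_reindex_bij_betw[OF bij, of "\<lambda>i. norm (w i)"] by simp
  then have sumM: "summable (\<lambda>k. C * norm (w (int_decode k)))"
    by (intro summable_mult summable_on_imp_summable)
  have "(\<lambda>N. suminf (\<lambda>k. g N (int_decode k))) \<longlonglongrightarrow>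
      suminf (\<lambda>k. 1 / qpochhammer_inf q q * w (int_decode k))"
  proof (rule tannerys_theorem[THEN conjunct2, THEN conjunct2])
    fix k
    let ?i = "int_decode k"
    have "(\<lambda>N. gauss_binomial q (2*N) (nat (?i + int N)) * w ?i) \<longlonglongrightarrow>
        1 / qpochhammer_inf q q * w ?i"
      by (intro tendsto_intros gauss_binomial_central_LIMSEQ q)
    moreover have "eventually (\<lambda>N. gauss_binomial q (2*N) (nat (?i + int N)) * w ?i = g N ?i) sequentially"
      using eventually_ge_at_top[of "nat \<bar>?i\<bar>"] by eventually_elim (auto simp: g_def)
    ultimately show "(\<lambda>N. g N ?i) \<longlonglongrightarrow> 1 / qpochhammer_inf q q * w ?i"
      by (rule Lim_transform_eventually)
  next
    have "norm (g N i) \<le> C * norm (w i)" for N i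
    proof (cases "\<bar>i\<bar> \<le> int N")
      case True
      then have "nat (i + int N) \<le> 2 * N"
        by linarith
      then show ?thesis
        using True by (simp add: g_def norm_mult mult_right_mono C)
    qed (use C0 in \<open>simp add: g_def\<close>)
    then show "\<forall>\<^sub>F (k, N) in sequentially \<times>\<^sub>F sequentially.
        norm (g N (int_decode k)) \<le> C * norm (w (int_decode k))"
      by (intro always_eventually) auto
  qed (use sumM in auto)
  also have "(\<lambda>N. suminf (\<lambda>k. g N (int_decode k))) =
      (\<lambda>N. \<Sum>k\<le>2*N. gauss_binomial q (2*N) k * w (int k - int N))"
  proof
    fix N
    have "suminf (\<lambda>k. g N (int_decode k)) = (\<Sum>k\<in>int_encode ` {- int N..int N}. g N (int_decode k))"
    proof (rule suminf_finite)
      fix n assume "n \<notin> int_encode ` {- int N..int N}"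
      then have "int_decode n \<notin> {- int N..int N}"
        by (metis image_eqI int_decode_inverse)
      then show "g N (int_decode n) = 0"
        by (auto simp: g_def)
    qed simp
    also have "\<dots> = (\<Sum>i\<in>{- int N..int N}. g N i)"
      by (subst sum.reindex) (auto intro: inj_onI simp: int_encode_eq)
    also have "\<dots> = (\<Sum>k\<le>2*N. gauss_binomial q (2*N) k * w (int k - int N))"
      by (rule sum.reindex_bij_witness[of _ "\<lambda>k. int k - int N" "\<lambda>i. nat (i + int N)"])
         (auto simp: g_def)
    finally show "suminf (\<lambda>k. g N (int_decode k)) =
      (\<Sum>k\<le>2*N. gauss_binomial q (2*N) k * w (int k - int N))" .
  qed
  also have "suminf (\<lambda>k. 1 / qpochhammer_inf q q * w (int_decode k)) =
      1 / qpochhammer_inf q q * (\<Sum>\<^sub>\<infinity>i. w i)"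
  proof -
    have "w summable_on UNIV"
      using w by (rule abs_summable_summable)
    then have "((\<lambda>k. w (int_decode k)) has_sum (\<Sum>\<^sub>\<infinity>i. w i)) UNIV"
      using has_sum_reindex_bij_betw[OF bij, of w] by simp
    then have "(\<lambda>k. w (int_decode k)) sums (\<Sum>\<^sub>\<infinity>i. w i)"
      by (rule has_sum_imp_sums)
    then show ?thesis
      by (intro sums_unique[symmetric] sums_mult)
  qed
  finally show ?thesis
    by simp
qed

theorem jacobi_triple_product:
  fixes z q :: complex
  assumes q: "norm q < 1" "q \<noteq> 0" and z: "z \<noteq> 0"
  shows "(\<Sum>\<^sub>\<infinity>i. z powi i * q powi (i * (i - 1) div 2)) =
    qpochhammer_inf q q * qpochhammer_inf (- z) q * qpochhammer_inf (- (q / z)) q"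
proof -
  have nz: "qpochhammer_inf q q \<noteq> 0"
    using q by (intro qpochhammer_inf_nonzero')
  let ?w = "\<lambda>i. z powi i * q powi (i * (i - 1) div 2)"
  have "(\<lambda>N. (\<Prod>k<N. 1 - (- z) * q ^ k) * (\<Prod>k<N. 1 - (- (q / z)) * q ^ k)) \<longlonglongrightarrow>
     qpochhammer_inf (- z) q * qpochhammer_inf (- (q / z)) q"
    by (intro tendsto_mult qpochhammer_inf_LIMSEQ q)
  moreover have "(\<lambda>N. (\<Prod>k<N. 1 - (- z) * q ^ k) * (\<Prod>k<N. 1 - (- (q / z)) * q ^ k)) =
     (\<lambda>N. \<Sum>k\<le>2*N. gauss_binomial q (2*N) k * ?w (int k - int N))"
    using finite_triple_product[OF q(2) z] by simp
  moreover have "(\<lambda>N. \<Sum>k\<le>2*N. gauss_binomial q (2*N) k * ?w (int k - int N))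
      \<longlonglongrightarrow> (\<Sum>\<^sub>\<infinity>i. ?w i) / qpochhammer_inf q q"
    by (rule gauss_binomial_sum_LIMSEQ[OF q(1) theta_abs_summable[OF q z]])
  ultimately have "qpochhammer_inf (- z) q * qpochhammer_inf (- (q / z)) q =
      (\<Sum>\<^sub>\<infinity>i. ?w i) / qpochhammer_inf q q"
    by (simp only: LIMSEQ_unique)
  then show ?thesis
    using nz by (simp add: field_simps)
qed


text \<open>Both sides of the finite triple product at \<open>- z\<close> vanish at \<open>z = 1\<close>; comparing their
  derivatives there and letting the length tend to infinity gives the cube.\<close>

lemma finite_triple_product_deriv:
  fixes q :: complex
  assumes "q \<noteq> 0"
  shows "- ((\<Prod>k<N. 1 - q * q ^ k) * (\<Prod>k<Suc N. 1 - q * q ^ k)) =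
    (\<Sum>k\<le>2 * Suc N. gauss_binomial q (2 * Suc N) k *
      (of_int (int k - int (Suc N)) * (- 1) powi (int k - int (Suc N)) *
         q powi ((int k - int (Suc N)) * (int k - int (Suc N) - 1) div 2)))"
proof -
  \<comment> \<open>The finite product at - z without its vanishing factor 1 - z, the one for k = 0;
    this is why the two products differ in length by one. The derivative of (1 - z) G at 1 is then -
    G 1.\<close>
  define G where "G z = (\<Prod>k<N. 1 - z * (q * q ^ k)) * (\<Prod>k<Suc N. 1 - q * q ^ k / z)" for z
  define c where "c k = gauss_binomial q (2 * Suc N) k *
     ((- 1) powi (int k - int (Suc N)) * q powi ((int k - int (Suc N)) * (int k - int (Suc N) - 1) div 2))" for k
  have eq: "(1 - z) * G z = (\<Sum>k\<le>2 * Suc N. c k * z powi (int k - int (Suc N)))" if "z \<noteq> 0" for z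
  proof -
    have "(\<Prod>k<Suc N. 1 + (- z) * q ^ k) = (1 - z) * (\<Prod>k<N. 1 - z * (q * q ^ k))"
      by (subst prod.lessThan_Suc_shift) (simp add: mult_ac)
    moreover have "(\<Prod>k<Suc N. 1 + q / (- z) * q ^ k) = (\<Prod>k<Suc N. 1 - q * q ^ k / z)"
      by simp
    ultimately have "(1 - z) * G z = (\<Prod>k<Suc N. 1 + (- z) * q ^ k) * (\<Prod>k<Suc N. 1 + q / (- z) * q ^ k)"
      unfolding G_def by (simp only: mult.assoc)
    also have "\<dots> = (\<Sum>k\<le>2 * Suc N. gauss_binomial q (2 * Suc N) k *
      ((- z) powi (int k - int (Suc N)) * q powi ((int k - int (Suc N)) * (int k - int (Suc N) - 1) div 2)))"
      using assms that by (intro finite_triple_product) auto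
    also have "\<dots> = (\<Sum>k\<le>2 * Suc N. c k * z powi (int k - int (Suc N)))"
    proof (rule sum.cong)
      fix k
      have "(- z) powi j = (- 1) powi j * z powi j" for j
        using power_int_mult_distrib[of "-1" z j] by simp
      then show "gauss_binomial q (2 * Suc N) k *
          ((- z) powi (int k - int (Suc N)) * q powi ((int k - int (Suc N)) * (int k - int (Suc N) - 1) div 2)) =
          c k * z powi (int k - int (Suc N))"
        by (simp only: c_def mult_ac)
    qed simp
    finally show ?thesis .
  qed
  have "G holomorphic_on - {0}"
    unfolding G_def by (intro holomorphic_intros) auto
  then have "G field_differentiable at 1"
    by (rule holomorphic_on_imp_differentiable_at) auto
  then obtain G' where G': "(G has_field_derivative G') (at 1)"
    by (auto simp: field_differentiable_def)
  have d: "((\<lambda>z. (1 - z) * G z) has_field_derivative - G 1) (at 1)"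
    by (auto intro!: derivative_eq_intros G')
  have ev: "eventually (\<lambda>z. (1 - z) * G z = (\<Sum>k\<le>2 * Suc N. c k * z powi (int k - int (Suc N)))) (nhds 1)"
  proof (rule eventually_mono)
    show "eventually (\<lambda>z. z \<in> - {0}) (nhds (1 :: complex))"
      by (rule eventually_nhds_in_open) auto
  qed (rule eq, simp)
  have "((\<lambda>z. \<Sum>k\<le>2 * Suc N. c k * z powi (int k - int (Suc N))) has_field_derivative - G 1) (at 1)"
    by (rule DERIV_cong_ev[OF refl ev refl, THEN iffD1, OF d])
  moreover have "((\<lambda>z. \<Sum>k\<le>2 * Suc N. c k * z powi (int k - int (Suc N))) has_field_derivative
      (\<Sum>k\<le>2 * Suc N. c k * of_int (int k - int (Suc N)))) (at 1)"
    by (auto intro!: derivative_eq_intros sum.cong)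
  ultimately have "- G 1 = (\<Sum>k\<le>2 * Suc N. c k * of_int (int k - int (Suc N)))"
    by (rule DERIV_unique)
  then show ?thesis
    by (simp add: G_def c_def mult_ac del: prod.lessThan_Suc sum.atMost_Suc of_int_diff)
qed

text \<open>Absorbs the linear factor created by differentiation: a theta series weighted by i is
  dominated by the unweighted ones at 2 z and z / 2.\<close>

lemma norm_of_int_le: "norm (of_int i :: complex) \<le> norm ((2::complex) powi i) + norm ((1 / 2 :: complex) powi i)"
proof -
  have *: "real n \<le> 2 ^ n" for n
    using of_nat_less_two_power[of n, where 'a=real] by simp
  have **: "norm (2 powi int n :: complex) = 2 ^ n" "norm ((1/2) powi (- int n) :: complex) = 2 ^ n" for n
    by (simp_all add: norm_power power_int_minus norm_inverse power_divide norm_divide)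
  show ?thesis
  proof (cases "i \<ge> 0")
    case True
    then obtain n where "i = int n"
      using nonneg_int_cases by blast
    then show ?thesis
      using *[of n] **(1)[of n] by (simp add: add_increasing2)
  next
    case False
    then obtain n where "i = - int n"
      by (metis int_cases2 linorder_le_cases of_nat_0_le_iff)
    then show ?thesis
      using *[of n] **(2)[of n] by (simp add: add_increasing)
  qed
qed

lemma theta_deriv_abs_summable:
  fixes z q :: complex
  assumes "norm q < 1" "q \<noteq> 0" "z \<noteq> 0"
  shows "(\<lambda>i. norm (of_int i * z powi i * q powi (i * (i - 1) div 2))) summable_on UNIV"
proof (rule summable_on_comparison_test)
  let ?e = "\<lambda>i::int. i * (i - 1) div 2"
  show "(\<lambda>i. norm ((2 * z) powi i * q powi ?e i) + norm ((z / 2) powi i * q powi ?e i)) summable_on UNIV"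
    using assms by (intro summable_on_add theta_abs_summable) auto
  show "norm (of_int i * z powi i * q powi ?e i) \<le>
      norm ((2 * z) powi i * q powi ?e i) + norm ((z / 2) powi i * q powi ?e i)" for i
  proof -
    have "norm (of_int i * z powi i * q powi ?e i) \<le>
       (norm ((2::complex) powi i) + norm ((1 / 2 :: complex) powi i)) * norm (z powi i * q powi ?e i)"
      unfolding mult.assoc norm_mult[of "of_int i"] by (intro mult_right_mono norm_of_int_le) auto
    also have "\<dots> = norm ((2 * z) powi i * q powi ?e i) + norm ((1 / 2 * z) powi i * q powi ?e i)"
      unfolding power_int_mult_distrib by (simp only: norm_mult algebra_simps)
    finally show ?thesis
      by simp
  qed
qed auto

theorem jacobi_cube:
  fixes q :: complex
  assumes q: "norm q < 1" "q \<noteq> 0"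
  shows "qpochhammer_inf q q ^ 3 = - (\<Sum>\<^sub>\<infinity>i. of_int i * (- 1) powi i * q powi (i * (i - 1) div 2))"
proof -
  let ?w = "\<lambda>i. of_int i * (- 1) powi i * q powi (i * (i - 1) div 2)"
  let ?E = "qpochhammer_inf q q"
  let ?s = "\<lambda>N. \<Sum>k\<le>2*N. gauss_binomial q (2*N) k * ?w (int k - int N)"
  have nz: "?E \<noteq> 0"
    using q by (intro qpochhammer_inf_nonzero')
  have "?s \<longlonglongrightarrow> (\<Sum>\<^sub>\<infinity>i. ?w i) / ?E"
    using q by (intro gauss_binomial_sum_LIMSEQ theta_deriv_abs_summable) auto
  then have "(\<lambda>N. ?s (Suc N)) \<longlonglongrightarrow> (\<Sum>\<^sub>\<infinity>i. ?w i) / ?E"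
    by (rule LIMSEQ_Suc)
  moreover have "(\<lambda>N. - ((\<Prod>k<N. 1 - q * q ^ k) * (\<Prod>k<Suc N. 1 - q * q ^ k))) \<longlonglongrightarrow> - (?E * ?E)"
    by (intro tendsto_intros LIMSEQ_Suc[OF qpochhammer_inf_LIMSEQ] qpochhammer_inf_LIMSEQ q)
  ultimately have "(\<Sum>\<^sub>\<infinity>i. ?w i) / ?E = - (?E * ?E)"
    unfolding finite_triple_product_deriv[OF q(2)] by (rule LIMSEQ_unique)
  then show ?thesis
    using nz by (simp add: field_simps power3_eq_cube)
qed

subsection \<open>Theta functions as lattice sums and as products\<close>

abbreviation eulerE :: "complex \<Rightarrow> complex" where
  "eulerE q \<equiv> qpochhammer_inf q q"

definition ramanujan_phi :: "complex \<Rightarrow> complex" where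
  "ramanujan_phi q = (\<Sum>\<^sub>\<infinity>n::int. q ^ nat (n\<^sup>2))"

text \<open>Summing over all integers the exponents \<open>2 m\<^sup>2 + m\<close> lists every triangular number once.\<close>

definition ramanujan_psi :: "complex \<Rightarrow> complex" where
  "ramanujan_psi q = (\<Sum>\<^sub>\<infinity>m::int. q ^ nat (2 * m\<^sup>2 + m))"

lemma tri_double: "2 * (i * (i - 1) div 2) = i * (i - 1)" for i :: int
  by (simp add: dvd_mult_div_cancel)

lemma norm_power_less_one:
  assumes "norm (q :: complex) < 1" "n > 0"
  shows "norm (q ^ n) < 1"
  using assms by (simp add: norm_power power_less_one_iff)

lemma two_msq_nonneg: "2 * m\<^sup>2 + m \<ge> 0" for m :: int
proof (cases "m \<ge> 0")
  case False
  then have "m * (2 * m + 1) \<ge> 0"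
    by (intro mult_nonpos_nonpos) auto
  then show ?thesis
    by (simp add: power2_eq_square algebra_simps)
qed simp

lemma theta_phi_term:
  assumes "q \<noteq> (0 :: complex)"
  shows "q powi i * (q\<^sup>2) powi (i * (i - 1) div 2) = q ^ nat (i\<^sup>2)"
proof -
  have "(q\<^sup>2) powi (i * (i - 1) div 2) = q powi (i * (i - 1))"
    by (simp only: power_int_power of_nat_numeral tri_double)
  then have "q powi i * (q\<^sup>2) powi (i * (i - 1) div 2) = q powi (i + i * (i - 1))"
    using assms by (simp add: power_int_add)
  also have "i + i * (i - 1) = i\<^sup>2"
    by (simp add: power2_eq_square algebra_simps)
  finally show ?thesis
    by (simp add: power_int_nonneg_exp)
qed

lemma theta_psi_term:
  assumes "q \<noteq> (0 :: complex)"
  shows "(q ^ 3) powi i * (q ^ 4) powi (i * (i - 1) div 2) = q ^ nat (2 * i\<^sup>2 + i)"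
proof -
  have "4 * (i * (i - 1) div 2) = 2 * (i * (i - 1))"
    using tri_double[of i] by simp
  then have "(q ^ 4) powi (i * (i - 1) div 2) = q powi (2 * (i * (i - 1)))"
    by (simp only: power_int_power of_nat_numeral)
  then have "(q ^ 3) powi i * (q ^ 4) powi (i * (i - 1) div 2) = q powi (3 * i + 2 * (i * (i - 1)))"
    using assms by (simp add: power_int_add power_int_power)
  also have "3 * i + 2 * (i * (i - 1)) = 2 * i\<^sup>2 + i"
    by (simp add: power2_eq_square algebra_simps)
  finally show ?thesis
    using two_msq_nonneg[of i] by (simp add: power_int_nonneg_exp)
qed

lemma phi_abs_summable:
  assumes "norm (q :: complex) < 1" "q \<noteq> 0"
  shows "(\<lambda>i. norm (q ^ nat (i\<^sup>2))) summable_on UNIV"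
  using theta_abs_summable[of "q\<^sup>2" q] assms
  by (simp add: norm_power_less_one theta_phi_term)

lemma psi_abs_summable:
  assumes "norm (q :: complex) < 1" "q \<noteq> 0"
  shows "(\<lambda>i. norm (q ^ nat (2 * i\<^sup>2 + i))) summable_on UNIV"
  using theta_abs_summable[of "q ^ 4" "q ^ 3"] assms
  by (simp add: norm_power_less_one theta_psi_term)

lemma eulerE_nonzero: "norm q < 1 \<Longrightarrow> eulerE q \<noteq> 0"
  by (rule qpochhammer_inf_nonzero')

section \<open>Theta functions as quotients of Euler products\<close>

lemma qpochhammer_odd:
  assumes "norm q < 1"
  shows "qpochhammer_inf q (q\<^sup>2) = eulerE q / eulerE (q\<^sup>2)"
  using qpochhammer_inf_split[OF assms, of q] eulerE_nonzero[OF norm_power_less_one[OF assms, of 2]]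
  by (simp add: power2_eq_square)

lemma qpochhammer_neg_odd:
  assumes "norm q < 1"
  shows "qpochhammer_inf (- q) (q\<^sup>2) = eulerE (q\<^sup>2) ^ 2 / (eulerE q * eulerE (q ^ 4))"
proof -
  have q2: "norm (q\<^sup>2) < 1" "norm (q ^ 4) < 1"
    using norm_power_less_one[OF assms] by simp_all
  note nz = eulerE_nonzero[OF assms] eulerE_nonzero[OF q2(1)] eulerE_nonzero[OF q2(2)]
  have "qpochhammer_inf q (q\<^sup>2) * qpochhammer_inf (- q) (q\<^sup>2) = qpochhammer_inf (q\<^sup>2) ((q\<^sup>2)\<^sup>2)"
    by (rule qpochhammer_inf_square[OF q2(1)])
  then have "eulerE q / eulerE (q\<^sup>2) * qpochhammer_inf (- q) (q\<^sup>2) = eulerE (q\<^sup>2) / eulerE (q ^ 4)"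
    unfolding qpochhammer_odd[OF assms] qpochhammer_odd[OF q2(1)] by simp
  then show ?thesis
    using nz by (simp add: field_simps power2_eq_square)
qed

text \<open>Transfers formulas between q and - q: the product for phi(- q) is the simpler one, and
  phi(q) and psi(- q) follow by this substitution.\<close>

lemma eulerE_neg:
  assumes "norm q < 1"
  shows "eulerE (- q) = eulerE (q\<^sup>2) ^ 3 / (eulerE q * eulerE (q ^ 4))"
proof -
  have "eulerE (- q) = qpochhammer_inf (- q) (q\<^sup>2) * qpochhammer_inf (q\<^sup>2) (q\<^sup>2)"
    using qpochhammer_inf_split[of "- q" "- q"] assms by (simp add: power2_eq_square)
  then show ?thesis
    unfolding qpochhammer_neg_odd[OF assms]
    by (simp add: power2_eq_square[of "eulerE (q\<^sup>2)"] power3_eq_cube)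
qed

lemma phi_neg_eq:
  assumes "norm q < 1" "q \<noteq> 0"
  shows "ramanujan_phi (- q) = eulerE q ^ 2 / eulerE (q\<^sup>2)"
proof -
  have q2: "norm (q\<^sup>2) < 1"
    using norm_power_less_one[OF assms(1)] by simp
  have "ramanujan_phi (- q) = (\<Sum>\<^sub>\<infinity>i. (- q) powi i * ((- q)\<^sup>2) powi (i * (i - 1) div 2))"
    using assms unfolding ramanujan_phi_def by (subst theta_phi_term) auto
  also have "\<dots> = eulerE (q\<^sup>2) * qpochhammer_inf q (q\<^sup>2) * qpochhammer_inf q (q\<^sup>2)"
    using jacobi_triple_product[of "q\<^sup>2" "- q"] assms q2 by (simp add: power2_eq_square)
  finally show ?thesis
    using eulerE_nonzero[OF q2] unfolding qpochhammer_odd[OF assms(1)]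
    by (simp add: power2_eq_square[of "eulerE q"])
qed

lemma phi_eq:
  assumes "norm q < 1" "q \<noteq> 0"
  shows "ramanujan_phi q = eulerE (q\<^sup>2) ^ 5 / (eulerE q ^ 2 * eulerE (q ^ 4) ^ 2)"
proof -
  have "eulerE (q\<^sup>2) \<noteq> 0"
    using eulerE_nonzero norm_power_less_one[OF assms(1)] by simp
  then show ?thesis
    using phi_neg_eq[of "- q"] assms
    by (simp add: eulerE_neg power_divide power_mult_distrib power_mult[symmetric])
       (simp add: field_simps eval_nat_numeral)
qed

lemma psi_eq:
  assumes "norm q < 1" "q \<noteq> 0"
  shows "ramanujan_psi q = eulerE (q\<^sup>2) ^ 2 / eulerE q"
proof -
  have q4: "norm (q ^ 4) < 1" and q2: "norm (q\<^sup>2) < 1"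
    using norm_power_less_one[OF assms(1)] by simp_all
  have e: "q ^ 4 / q ^ 3 = q"
    using assms by (simp add: eval_nat_numeral)
  have "ramanujan_psi q = (\<Sum>\<^sub>\<infinity>i. (q ^ 3) powi i * (q ^ 4) powi (i * (i - 1) div 2))"
    using assms unfolding ramanujan_psi_def by (subst theta_psi_term) auto
  also have "\<dots> = eulerE (q ^ 4) * qpochhammer_inf (- (q ^ 3)) (q ^ 4) * qpochhammer_inf (- q) (q ^ 4)"
    using jacobi_triple_product[of "q ^ 4" "q ^ 3"] assms q4 by (simp add: e)
  \<comment> \<open>The triple product with base q^4 at z = q^3 yields the exponents 3 and 1 modulo
    4. Together these are all odd numbers, so the two products merge into one with base q^2.\<close>
  also have "\<dots> = eulerE (q ^ 4) * qpochhammer_inf (- q) (q\<^sup>2)"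
    using qpochhammer_inf_split[OF q2, of "- q"] by (simp add: power_mult[symmetric] eval_nat_numeral mult_ac)
  finally show ?thesis
    using eulerE_nonzero[OF q4] by (simp add: qpochhammer_neg_odd[OF assms(1)])
qed

section \<open>Products and derivatives of series over the integers\<close>

lemma has_sum_mult_Times:
  fixes f g :: "int \<Rightarrow> complex"
  assumes "(\<lambda>i. norm (f i)) summable_on UNIV" "(\<lambda>i. norm (g i)) summable_on UNIV"
  shows "((\<lambda>(i, j). f i * g j) has_sum ((\<Sum>\<^sub>\<infinity>i. f i) * (\<Sum>\<^sub>\<infinity>j. g j))) UNIV"
proof -
  have f: "f summable_on UNIV" and g: "g summable_on UNIV"
    using assms by (auto intro: abs_summable_summable)
  have "((\<lambda>(i, j). f i * g j) has_sum ((\<Sum>\<^sub>\<infinity>i. f i) * (\<Sum>\<^sub>\<infinity>j. g j))) (UNIV \<times> UNIV)"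
  proof (rule has_sum_SigmaI)
    show "((\<lambda>y. case (x, y) of (i, j) \<Rightarrow> f i * g j) has_sum f x * (\<Sum>\<^sub>\<infinity>j. g j)) UNIV" for x
      using g by (auto intro!: has_sum_cmult_right)
    show "((\<lambda>i. f i * (\<Sum>\<^sub>\<infinity>j. g j)) has_sum (\<Sum>\<^sub>\<infinity>i. f i) * (\<Sum>\<^sub>\<infinity>j. g j)) UNIV"
      using f by (auto intro!: has_sum_cmult_left)
    have "(\<lambda>(i, j). norm (f i) * norm (g j)) summable_on (UNIV \<times> UNIV)"
    proof (rule summable_on_SigmaI)
      show "((\<lambda>y. case (x, y) of (i, j) \<Rightarrow> norm (f i) * norm (g j)) has_sum norm (f x) * (\<Sum>\<^sub>\<infinity>j. norm (g j))) UNIV" for x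
        using assms(2) by (auto intro!: has_sum_cmult_right)
      show "(\<lambda>i. norm (f i) * (\<Sum>\<^sub>\<infinity>j. norm (g j))) summable_on UNIV"
        by (intro summable_on_cmult_left assms)
    qed auto
    then have "(\<lambda>p. norm (case p of (i, j) \<Rightarrow> f i * g j)) summable_on (UNIV \<times> UNIV)"
      by (simp add: case_prod_unfold norm_mult)
    then show "(\<lambda>(i, j). f i * g j) summable_on (UNIV \<times> UNIV)"
      by (rule abs_summable_summable)
  qed
  then show ?thesis
    by simp
qed

text \<open>Differentiation term by term, dominated by the series at a real radius r strictly
  between |q| and 1. It serves both phi(q) and psi(q^2).\<close>

lemma power_series_deriv:
  fixes e :: "int \<Rightarrow> nat" and q :: complex
  assumes summ: "\<And>q::complex. norm q < 1 \<Longrightarrow> q \<noteq> 0 \<Longrightarrow> (\<lambda>i. norm (q ^ e i)) summable_on UNIV"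
    and q: "norm q < 1" "q \<noteq> 0"
  shows "(\<lambda>i. norm (of_nat (e i) * q ^ e i)) summable_on UNIV" (is ?A)
    and "((\<lambda>q. \<Sum>\<^sub>\<infinity>i. q ^ e i) has_field_derivative (\<Sum>\<^sub>\<infinity>i. of_nat (e i) * q ^ e i) / q) (at q)" (is ?B)
proof -
  have bij: "bij int_decode"
    by (rule bij_int_decode)
  obtain r where r: "norm q < r" "r < 1"
    using dense q by blast
  then have r0: "r > 0"
    using norm_ge_zero[of q] by linarith
  have "(\<lambda>i. norm (of_real r ^ e i :: complex)) summable_on UNIV"
    using r r0 by (intro summ) auto
  then have "(\<lambda>k. norm (of_real r ^ e (int_decode k) :: complex)) summable_on UNIV"
    using summable_on_reindex_bij_betw[OF bij, of "\<lambda>i. norm (of_real r ^ e i :: complex)"] by simp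
  then have sr: "summable (\<lambda>k. r ^ e (int_decode k))"
    using r0 by (auto dest!: summable_on_imp_summable simp: norm_power)
  have "\<exists>g g'. \<forall>x\<in>ball (0 :: complex) r. ((\<lambda>k. x ^ e (int_decode k)) sums g x) \<and>
      ((\<lambda>k. of_nat (e (int_decode k)) * x ^ (e (int_decode k) - 1)) sums g' x) \<and>
      (g has_field_derivative g' x) (at x)"
  proof (rule series_and_derivative_comparison[OF _ sr])
    show "((\<lambda>x. x ^ e (int_decode k)) has_field_derivative
        of_nat (e (int_decode k)) * x ^ (e (int_decode k) - 1)) (at x)" for k and x :: complex
      by (auto intro!: derivative_eq_intros)
    show "\<forall>\<^sub>F k in sequentially. \<forall>x\<in>ball 0 r. norm (x ^ e (int_decode k) :: complex) \<le> r ^ e (int_decode k)"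
      by (intro always_eventually allI ballI) (auto simp: norm_power intro!: power_mono)
  qed auto
  then obtain g g' :: "complex \<Rightarrow> complex" where gg: "\<And>x. x \<in> ball 0 r \<Longrightarrow> (\<lambda>k. x ^ e (int_decode k)) sums g x"
    "\<And>x. x \<in> ball 0 r \<Longrightarrow> (\<lambda>k. of_nat (e (int_decode k)) * x ^ (e (int_decode k) - 1)) sums g' x"
    "\<And>x. x \<in> ball 0 r \<Longrightarrow> (g has_field_derivative g' x) (at x)"
    by blast
  have mult_q: "x * (of_nat (e i) * x ^ (e i - 1)) = of_nat (e i) * x ^ e i" for x :: complex and i
    by (cases "e i") auto
  have *: "(\<lambda>k. of_nat (e (int_decode k)) * x ^ e (int_decode k)) sums (x * g' x)" if "x \<in> ball 0 r" for x :: complex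
    using sums_mult[OF gg(2)[OF that], of x] by (simp only: mult_q)
  \<comment> \<open>At the real point |q| the differentiated series has nonnegative terms, so its
    convergence there is already absolute convergence at q.\<close>
  have "of_real (norm q) \<in> ball (0 :: complex) r"
    using r by simp
  from sums_Re[OF *[OF this]] have "summable (\<lambda>k. Re (of_nat (e (int_decode k)) * of_real (norm q) ^ e (int_decode k)))"
    by (rule sums_summable)
  then have "summable (\<lambda>k. norm (of_nat (e (int_decode k)) * q ^ e (int_decode k)))"
    by (simp add: norm_mult norm_power flip: of_real_power)
  then have "(\<lambda>k. norm (of_nat (e (int_decode k)) * q ^ e (int_decode k))) summable_on UNIV"
    by (intro summable_nonneg_imp_summable_on) auto
  then show A: ?A
    using summable_on_reindex_bij_betw[OF bij, of "\<lambda>i. norm (of_nat (e i) * q ^ e i)"] by simp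
  have infsum_sums: "(\<lambda>k. f (int_decode k)) sums (\<Sum>\<^sub>\<infinity>i. f i)"
    if "(\<lambda>i. norm (f i)) summable_on UNIV" for f :: "int \<Rightarrow> complex"
  proof -
    have "f summable_on UNIV"
      using that by (rule abs_summable_summable)
    then show ?thesis
      using has_sum_reindex_bij_betw[OF bij, of f] by (intro has_sum_imp_sums) simp
  qed
  have "g' q = (\<Sum>\<^sub>\<infinity>i. of_nat (e i) * q ^ e i) / q"
    using sums_unique2[OF *[of q] infsum_sums[OF A]] r q by (simp add: field_simps)
  moreover have "(g has_field_derivative g' q) (at q)"
    using r by (intro gg) auto
  moreover have "eventually (\<lambda>x. g x = (\<Sum>\<^sub>\<infinity>i. x ^ e i)) (nhds q)"
  proof (rule eventually_mono)
    show "eventually (\<lambda>x. x \<in> ball 0 r - {0}) (nhds q)"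
      using r q by (intro eventually_nhds_in_open) (auto intro: open_delete)
    show "g x = (\<Sum>\<^sub>\<infinity>i. x ^ e i)" if "x \<in> ball 0 r - {0}" for x
      using that r gg(1)[of x] by (intro sums_unique2[OF _ infsum_sums] summ) auto
  qed
  ultimately show ?B
    using DERIV_cong_ev[of q q g "\<lambda>x. \<Sum>\<^sub>\<infinity>i. x ^ e i" "g' q"] by auto
qed

subsection \<open>Lattice identities\<close>

lemma has_sum_phi:
  assumes "norm q < 1" "q \<noteq> 0"
  shows "((\<lambda>i. q ^ nat (i\<^sup>2)) has_sum ramanujan_phi q) UNIV"
  unfolding ramanujan_phi_def
  by (rule has_sum_infsum[OF abs_summable_summable[OF phi_abs_summable[OF assms]]])

lemma has_sum_psi:
  assumes "norm q < 1" "q \<noteq> 0"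
  shows "((\<lambda>i. q ^ nat (2 * i\<^sup>2 + i)) has_sum ramanujan_psi q) UNIV"
  unfolding ramanujan_psi_def
  by (rule has_sum_infsum[OF abs_summable_summable[OF psi_abs_summable[OF assms]]])

lemma has_sum_phi_sq:
  assumes "norm q < 1" "q \<noteq> 0"
  shows "((\<lambda>(m, n). q ^ nat (m\<^sup>2 + n\<^sup>2)) has_sum (ramanujan_phi q)\<^sup>2) UNIV"
proof -
  have "((\<lambda>(m, n). q ^ nat (m\<^sup>2) * q ^ nat (n\<^sup>2)) has_sum (ramanujan_phi q)\<^sup>2) UNIV"
    using has_sum_mult_Times[OF phi_abs_summable[OF assms] phi_abs_summable[OF assms]]
    by (simp add: ramanujan_phi_def power2_eq_square)
  then show ?thesis
    by (simp add: nat_add_distrib power_add)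
qed

text \<open>The sign of (- q)^(m^2 + n^2) leaves only the pairs with m + n even. They are the
  multiples of 1 + i in the Gaussian integers, and dividing by 1 + i halves the norm m^2 +
  n^2.\<close>

lemma phi_sq_sum:
  assumes "norm q < 1" "q \<noteq> 0"
  shows "(ramanujan_phi q)\<^sup>2 + (ramanujan_phi (- q))\<^sup>2 = 2 * (ramanujan_phi (q\<^sup>2))\<^sup>2"
proof -
  have "((\<lambda>p. (case p of (m, n) \<Rightarrow> q ^ nat (m\<^sup>2 + n\<^sup>2)) + (case p of (m, n) \<Rightarrow> (- q) ^ nat (m\<^sup>2 + n\<^sup>2)))
      has_sum (ramanujan_phi q)\<^sup>2 + (ramanujan_phi (- q))\<^sup>2) UNIV"
  proof (rule has_sum_add)
    show "((\<lambda>(m, n). q ^ nat (m\<^sup>2 + n\<^sup>2)) has_sum (ramanujan_phi q)\<^sup>2) UNIV"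
      by (rule has_sum_phi_sq[OF assms])
    show "((\<lambda>(m, n). (- q) ^ nat (m\<^sup>2 + n\<^sup>2)) has_sum (ramanujan_phi (- q))\<^sup>2) UNIV"
      using assms by (intro has_sum_phi_sq) simp_all
  qed
  also have "?this \<longleftrightarrow> ((\<lambda>(m, n). 2 * q ^ nat (m\<^sup>2 + n\<^sup>2))
      has_sum (ramanujan_phi q)\<^sup>2 + (ramanujan_phi (- q))\<^sup>2) {(m, n). even (m + n)}"
    by (rule has_sum_cong_neutral) (auto simp: even_nat_iff uminus_power_if split: if_splits)
  also have "\<dots> \<longleftrightarrow> ((\<lambda>(a, b). 2 * (q\<^sup>2) ^ nat (a\<^sup>2 + b\<^sup>2))
      has_sum (ramanujan_phi q)\<^sup>2 + (ramanujan_phi (- q))\<^sup>2) UNIV"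
  proof (rule has_sum_reindex_bij_witness[where i = "\<lambda>(a, b). (a + b, a - b)" and j = "\<lambda>(m, n). ((m + n) div 2, (m - n) div 2)"])
    fix p :: "int \<times> int" assume "p \<in> {(m, n). even (m + n)}"
    then obtain m n where p: "p = (m, n)" "even (m + n)" "even (m - n)"
      by auto
    obtain a b where ab: "m + n = 2 * a" "m - n = 2 * b"
      using p(2,3) by (elim evenE) blast
    then have mn: "m = a + b" "n = a - b"
      by auto
    show "(case case p of (m, n) \<Rightarrow> ((m + n) div 2, (m - n) div 2) of (a, b) \<Rightarrow> (a + b, a - b)) = p"
      by (simp add: p(1) mn)
    have "m\<^sup>2 + n\<^sup>2 = 2 * (a\<^sup>2 + b\<^sup>2)"
      by (simp add: mn power2_eq_square algebra_simps)
    then have "nat (m\<^sup>2 + n\<^sup>2) = 2 * nat (a\<^sup>2 + b\<^sup>2)"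
      by (simp only: nat_mult_distrib zero_le_numeral nat_numeral)
    then show "(case case p of (m, n) \<Rightarrow> ((m + n) div 2, (m - n) div 2) of (a, b) \<Rightarrow> 2 * (q\<^sup>2) ^ nat (a\<^sup>2 + b\<^sup>2)) =
        (case p of (m, n) \<Rightarrow> 2 * q ^ nat (m\<^sup>2 + n\<^sup>2))"
      by (simp add: p(1) ab power_mult)
  qed auto
  finally have "((\<lambda>(a, b). 2 * (q\<^sup>2) ^ nat (a\<^sup>2 + b\<^sup>2))
      has_sum (ramanujan_phi q)\<^sup>2 + (ramanujan_phi (- q))\<^sup>2) UNIV" .
  moreover have "((\<lambda>p. 2 * (case p of (a, b) \<Rightarrow> (q\<^sup>2) ^ nat (a\<^sup>2 + b\<^sup>2))) has_sum 2 * (ramanujan_phi (q\<^sup>2))\<^sup>2) UNIV"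
    using assms norm_power_less_one[OF assms(1), of 2] by (intro has_sum_cmult_right has_sum_phi_sq) auto
  ultimately show ?thesis
    by (intro has_sum_unique) (auto simp: case_prod_unfold)
qed

text \<open>Even squares give phi(q^4). The odd integers are 4 m + 1 and its negative, and (4 m +
  1)^2 = 1 + 8 (2 m^2 + m), so each class contributes q psi(q^8).\<close>

lemma phi_split:
  assumes "norm q < 1" "q \<noteq> 0"
  shows "ramanujan_phi q = ramanujan_phi (q ^ 4) + 2 * q * ramanujan_psi (q ^ 8)"
proof -
  let ?f = "\<lambda>i. q ^ nat (i\<^sup>2)"
  have n4: "norm (q ^ 4) < 1" and n8: "norm (q ^ 8) < 1"
    using norm_power_less_one[OF assms(1)] by simp_all
  have "((\<lambda>k. (q ^ 4) ^ nat (k\<^sup>2)) has_sum ramanujan_phi (q ^ 4)) UNIV"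
    using n4 assms by (intro has_sum_phi) auto
  also have "?this \<longleftrightarrow> (?f has_sum ramanujan_phi (q ^ 4)) (range (\<lambda>k. 2 * k))"
    by (subst has_sum_reindex)
       (auto simp: inj_on_def o_def power_mult_distrib nat_mult_distrib power_mult)
  finally have 0: "(?f has_sum ramanujan_phi (q ^ 4)) (range (\<lambda>k. 2 * k))" .
  have psi: "((\<lambda>m. q * (q ^ 8) ^ nat (2 * m\<^sup>2 + m)) has_sum q * ramanujan_psi (q ^ 8)) UNIV"
    using n8 assms by (intro has_sum_cmult_right has_sum_psi) auto
  have e: "q ^ nat ((4 * m + 1)\<^sup>2) = q * (q ^ 8) ^ nat (2 * m\<^sup>2 + m)" for m :: int
  proof -
    have "(4 * m + 1)\<^sup>2 = 1 + 8 * (2 * m\<^sup>2 + m)"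
      by (simp add: power2_eq_square algebra_simps)
    moreover have "nat (1 + 8 * x) = 1 + 8 * nat x" if "x \<ge> 0" for x
      using that by linarith
    ultimately have "nat ((4 * m + 1)\<^sup>2) = 1 + 8 * nat (2 * m\<^sup>2 + m)"
      using two_msq_nonneg[of m] by (simp only:)
    then show ?thesis
      by (simp add: power_mult)
  qed
  have e': "(- (4 * m) - 1)\<^sup>2 = (4 * m + 1)\<^sup>2" for m :: int
    by (simp add: power2_eq_square algebra_simps)
  have 1: "(?f has_sum q * ramanujan_psi (q ^ 8)) (range (\<lambda>m. 4 * m + 1))"
    using psi by (subst has_sum_reindex) (auto simp: inj_on_def o_def e)
  have 2: "(?f has_sum q * ramanujan_psi (q ^ 8)) (range (\<lambda>m. - (4 * m) - 1))"
    using psi by (subst has_sum_reindex) (auto simp: inj_on_def o_def e e')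
  have "(?f has_sum ramanujan_phi (q ^ 4) + q * ramanujan_psi (q ^ 8))
      (range (\<lambda>k. 2 * k) \<union> range (\<lambda>m. 4 * m + 1))"
  proof (rule has_sum_Un_disjoint[OF 0 1])
    have "2 * k \<noteq> 4 * m + 1" for k m :: int
      by presburger
    then show "range (\<lambda>k. 2 * k) \<inter> range (\<lambda>m. 4 * m + 1) = ({} :: int set)"
      by blast
  qed
  then have "(?f has_sum ramanujan_phi (q ^ 4) + q * ramanujan_psi (q ^ 8) + q * ramanujan_psi (q ^ 8))
      (range (\<lambda>k. 2 * k) \<union> range (\<lambda>m. 4 * m + 1) \<union> range (\<lambda>m. - (4 * m) - 1))"
  proof (rule has_sum_Un_disjoint[OF _ 2])
    have "2 * k \<noteq> - (4 * m) - 1" "4 * k + 1 \<noteq> - (4 * m) - 1" for k m :: int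
      by presburger+
    then show "(range (\<lambda>k. 2 * k) \<union> range (\<lambda>m. 4 * m + 1)) \<inter> range (\<lambda>m. - (4 * m) - 1) = ({} :: int set)"
      by blast
  qed
  also have "range (\<lambda>k. 2 * k) \<union> range (\<lambda>m. 4 * m + 1) \<union> range (\<lambda>m. - (4 * m) - 1) = (UNIV :: int set)"
  proof -
    have "i \<in> range (\<lambda>k. 2 * k) \<union> range (\<lambda>m. 4 * m + 1) \<union> range (\<lambda>m. - (4 * m) - 1)" for i :: int
    proof -
      define d r where "d = i div 4" and "r = i mod 4"
      have "i = 4 * d + r" "0 \<le> r" "r < 4"
        by (simp_all add: d_def r_def)
      moreover from this have "r = 0 \<or> r = 1 \<or> r = 2 \<or> r = 3"
        by presburger
      ultimately have "i = 2 * (2 * d) \<or> i = 4 * d + 1 \<or> i = 2 * (2 * d + 1) \<or> i = - (4 * (- d - 1)) - 1"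
        by (elim disjE) simp_all
      then show ?thesis
        by (elim disjE) (blast intro: range_eqI)+
    qed
    then show ?thesis
      by blast
  qed
  finally have "(?f has_sum ramanujan_phi (q ^ 4) + q * ramanujan_psi (q ^ 8) + q * ramanujan_psi (q ^ 8)) UNIV" .
  from has_sum_unique[OF has_sum_phi[OF assms] this] show ?thesis
    by simp
qed

lemma phi_mult_psi_sq:
  assumes "norm q < 1" "q \<noteq> 0"
  shows "ramanujan_phi q * ramanujan_psi (q\<^sup>2) = (ramanujan_psi q)\<^sup>2"
proof -
  have n: "norm (q\<^sup>2) < 1" "norm (q ^ 4) < 1"
    using norm_power_less_one[OF assms(1)] by simp_all
  note nz = eulerE_nonzero[OF assms(1)] eulerE_nonzero[OF n(1)] eulerE_nonzero[OF n(2)]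
  have "b ^ 5 / (a\<^sup>2 * c\<^sup>2) * (c\<^sup>2 / b) = (b\<^sup>2 / a)\<^sup>2" if "b \<noteq> 0" "c \<noteq> 0" for a b c :: complex
    using that by (simp add: power_divide divide_simps) (simp add: eval_nat_numeral)
  note this[OF nz(2,3), of "eulerE q"]
  moreover have "ramanujan_psi (q\<^sup>2) = eulerE (q ^ 4) ^ 2 / eulerE (q\<^sup>2)"
    using psi_eq[OF n(1)] assms by (simp add: power_mult[symmetric])
  ultimately show ?thesis
    unfolding phi_eq[OF assms] psi_eq[OF assms] by (simp only:)
qed

text \<open>Factor the difference of fourth powers: \<open>phi_sq_sum\<close> gives the sum of
  squares, \<open>phi_split\<close> their difference, and \<open>phi_mult_psi_sq\<close> at q^4 and
  q^2 recombines the factors. This is what makes 1 - alpha a theta quotient.\<close>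

lemma jacobi_quartic:
  assumes "norm q < 1" "q \<noteq> 0"
  shows "ramanujan_phi q ^ 4 = ramanujan_phi (- q) ^ 4 + 16 * q * ramanujan_psi (q\<^sup>2) ^ 4"
proof -
  have n: "norm (q\<^sup>2) < 1" "norm (q ^ 4) < 1"
    using norm_power_less_one[OF assms(1)] by simp_all
  have m: "ramanujan_phi (q ^ 4) * ramanujan_psi (q ^ 8) = (ramanujan_psi (q ^ 4))\<^sup>2"
    "ramanujan_phi (q\<^sup>2) * ramanujan_psi (q ^ 4) = (ramanujan_psi (q\<^sup>2))\<^sup>2"
    using phi_mult_psi_sq[OF n(2)] phi_mult_psi_sq[OF n(1)] assms by (simp_all add: power_mult[symmetric])
  have s: "ramanujan_phi q = ramanujan_phi (q ^ 4) + 2 * q * ramanujan_psi (q ^ 8)"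
    "ramanujan_phi (- q) = ramanujan_phi (q ^ 4) - 2 * q * ramanujan_psi (q ^ 8)"
    using phi_split[of q] phi_split[of "- q"] assms by simp_all
  have "(ramanujan_phi q)\<^sup>2 - (ramanujan_phi (- q))\<^sup>2 = 8 * q * (ramanujan_phi (q ^ 4) * ramanujan_psi (q ^ 8))"
    unfolding s by (simp add: power2_eq_square algebra_simps)
  then have d: "(ramanujan_phi q)\<^sup>2 - (ramanujan_phi (- q))\<^sup>2 = 8 * q * (ramanujan_psi (q ^ 4))\<^sup>2"
    by (simp only: m)
  have "ramanujan_phi q ^ 4 - ramanujan_phi (- q) ^ 4 =
      ((ramanujan_phi q)\<^sup>2 + (ramanujan_phi (- q))\<^sup>2) * ((ramanujan_phi q)\<^sup>2 - (ramanujan_phi (- q))\<^sup>2)"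
    by (simp add: eval_nat_numeral algebra_simps)
  also have "\<dots> = 16 * q * (ramanujan_phi (q\<^sup>2) * ramanujan_psi (q ^ 4))\<^sup>2"
    unfolding phi_sq_sum[OF assms] d by (simp add: power_mult_distrib)
  also have "\<dots> = 16 * q * ramanujan_psi (q\<^sup>2) ^ 4"
    unfolding m by simp
  finally show ?thesis
    by (simp add: algebra_simps)
qed

text \<open>With \<open>a = 4 m + 1\<close> and \<open>b = 4 n + 1\<close> the exponent on the left is \<open>(a\<^sup>2 + 7 b\<^sup>2) / 8 - 1\<close>, and the
  bijection is multiplication by \<open>(1 + \<surd>-7) / 2\<close>, of norm 2, up to sign.\<close>

lemma psi_psi7_odd_part:
  assumes "norm q < 1" "q \<noteq> 0"
  shows "ramanujan_psi q * ramanujan_psi (q ^ 7) - ramanujan_psi (- q) * ramanujan_psi (- (q ^ 7)) =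
    2 * q * ramanujan_psi (q\<^sup>2) * ramanujan_psi (q ^ 14)"
proof -
  let ?e = "\<lambda>m::int. nat (2 * m\<^sup>2 + m)"
  let ?L = "ramanujan_psi q * ramanujan_psi (q ^ 7) - ramanujan_psi (- q) * ramanujan_psi (- (q ^ 7))"
  have prod: "((\<lambda>(m, n). x ^ ?e m * y ^ ?e n) has_sum ramanujan_psi x * ramanujan_psi y) UNIV"
    if "norm x < 1" "x \<noteq> 0" "norm y < 1" "y \<noteq> 0" for x y
    unfolding ramanujan_psi_def using that by (intro has_sum_mult_Times psi_abs_summable)
  have n: "norm (q ^ k) < 1" if "k > 0" for k
    using norm_power_less_one[OF assms(1) that] .
  have m7: "(- q) ^ 7 = - (q ^ 7)"
    by simp
  have ev: "even (?e m) \<longleftrightarrow> even m" for m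
    using two_msq_nonneg[of m] by (simp add: even_nat_iff)
  have "((\<lambda>p. (case p of (m, n) \<Rightarrow> q ^ ?e m * (q ^ 7) ^ ?e n) +
      - (case p of (m, n) \<Rightarrow> (- q) ^ ?e m * (- (q ^ 7)) ^ ?e n)) has_sum ?L) UNIV"
    unfolding diff_conv_add_uminus using assms n by (intro has_sum_add has_sum_uminusI prod) auto
  also have "?this \<longleftrightarrow> ((\<lambda>(m, n). 2 * (q ^ ?e m * (q ^ 7) ^ ?e n)) has_sum ?L) {(m, n). odd (m + n)}"
    by (rule has_sum_cong_neutral) (auto simp: uminus_power_if ev split: if_splits)
  \<comment> \<open>With A = 4 k + 1 and B = 4 l + 1, \<open>j\<close> is A = (a + 7 b) / 4, B = (b
    - a) / 4 up to a common sign, and \<open>i\<close> is a = (A - 7 B) / 2, b = (A + B) / 2 up to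
    the same sign. The sign that makes both results congruent to 1 modulo 4 accounts for the two
    cases.\<close>
  also have "\<dots> \<longleftrightarrow> ((\<lambda>(k, l). 2 * q * ((q\<^sup>2) ^ ?e k * (q ^ 14) ^ ?e l)) has_sum ?L) UNIV"
  proof (rule has_sum_reindex_bij_witness[where
      i = "\<lambda>(k, l). if even (k + l) then ((k - 7 * l) div 2 - 1, (k + l) div 2)
                    else ((7 * l - k + 1) div 2, - ((k + l + 1) div 2))" and
      j = "\<lambda>(m, n). if (n - m) mod 4 = 1 then ((7 * n + m + 1) div 4, (n - m - 1) div 4)
                    else (- ((7 * n + m + 3) div 4), (m - n - 1) div 4)"])
    fix p :: "int \<times> int" assume "p \<in> {(m, n). odd (m + n)}"
    then obtain m n where p: "p = (m, n)" "odd (m + n)"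
      by auto
    let ?i = "\<lambda>(k, l). if even (k + l) then ((k - 7 * l) div 2 - 1, (k + l) div 2)
                    else ((7 * l - k + 1) div 2, - ((k + l + 1) div 2))"
    let ?j = "\<lambda>(m, n). if (n - m) mod 4 = 1 then ((7 * n + m + 1) div 4, (n - m - 1) div 4)
                    else (- ((7 * n + m + 3) div 4), (m - n - 1) div 4)"
    have "\<exists>k l. ?j p = (k, l) \<and> ?i (k, l) = (m, n) \<and>
      (2 * m\<^sup>2 + m) + 7 * (2 * n\<^sup>2 + n) = 1 + 2 * (2 * k\<^sup>2 + k) + 14 * (2 * l\<^sup>2 + l)"
    proof (cases "(n - m) mod 4 = 1")
      case True
      define l where "l = (n - m - 1) div 4"
      have l: "n = m + 4 * l + 1"
        using True unfolding l_def by presburger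
      have j: "?j p = (2 * m + 7 * l + 2, l)"
      proof -
        have "(7 * n + m + 1) div 4 = 2 * m + 7 * l + 2"
          unfolding l by simp
        then show ?thesis
          using True by (simp add: p(1) l_def[symmetric])
      qed
      have "even (2 * m + 7 * l + 2 + l)" "(2 * m + 7 * l + 2 - 7 * l) div 2 - 1 = m"
        "(2 * m + 7 * l + 2 + l) div 2 = m + 4 * l + 1"
        by presburger+
      then have "?i (2 * m + 7 * l + 2, l) = (m, n)"
        unfolding l by (simp only: prod.case if_True simp_thms)
      moreover have "(2 * m\<^sup>2 + m) + 7 * (2 * n\<^sup>2 + n) =
          1 + 2 * (2 * (2 * m + 7 * l + 2)\<^sup>2 + (2 * m + 7 * l + 2)) + 14 * (2 * l\<^sup>2 + l)"
        unfolding l by (simp add: power2_eq_square algebra_simps)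
      ultimately show ?thesis
        using j by (intro exI conjI)
    next
      case False
      define l where "l = (m - n - 1) div 4"
      have l: "m = n + 4 * l + 1"
        using False p(2) unfolding l_def by presburger
      have j: "?j p = (- (2 * n + l + 1), l)"
      proof -
        have "(7 * n + m + 3) div 4 = 2 * n + l + 1"
          unfolding l by simp
        then show ?thesis
          using False by (simp add: p(1) l_def[symmetric])
      qed
      have "\<not> even (- (2 * n + l + 1) + l)" "(7 * l - (- (2 * n + l + 1)) + 1) div 2 = n + 4 * l + 1"
        "- ((- (2 * n + l + 1) + l + 1) div 2) = n"
        by presburger+
      then have "?i (- (2 * n + l + 1), l) = (m, n)"
        unfolding l by (simp only: prod.case if_False simp_thms)
      moreover have "(2 * m\<^sup>2 + m) + 7 * (2 * n\<^sup>2 + n) =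
          1 + 2 * (2 * (- (2 * n + l + 1))\<^sup>2 + (- (2 * n + l + 1))) + 14 * (2 * l\<^sup>2 + l)"
        unfolding l by (simp add: power2_eq_square algebra_simps)
      ultimately show ?thesis
        using j by (intro exI conjI)
    qed
    then obtain k l where j: "?j p = (k, l)" and i: "?i (k, l) = (m, n)" and
      *: "(2 * m\<^sup>2 + m) + 7 * (2 * n\<^sup>2 + n) = 1 + 2 * (2 * k\<^sup>2 + k) + 14 * (2 * l\<^sup>2 + l)"
      by blast
    show "?i (?j p) = p"
      unfolding j unfolding i p(1) ..
    have eqn: "q ^ ?e m * (q ^ 7) ^ ?e n = q * ((q\<^sup>2) ^ ?e k * (q ^ 14) ^ ?e l)"
    proof -
      have "?e m + 7 * ?e n = 1 + 2 * ?e k + 14 * ?e l"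
      proof -
        have "nat a + 7 * nat b = 1 + 2 * nat c + 14 * nat d"
          if "a + 7 * b = 1 + 2 * c + 14 * d" "a \<ge> 0" "b \<ge> 0" "c \<ge> 0" "d \<ge> 0" for a b c d
          using that by linarith
        then show ?thesis
          using * two_msq_nonneg by blast
      qed
      then have "q ^ (?e m + 7 * ?e n) = q ^ (1 + 2 * ?e k + 14 * ?e l)"
        by (rule arg_cong)
      then show ?thesis
        by (simp only: power_add power_mult power_one_right mult.assoc)
    qed
    show "(case ?j p of (k, l) \<Rightarrow> 2 * q * ((q\<^sup>2) ^ ?e k * (q ^ 14) ^ ?e l)) =
        (case p of (m, n) \<Rightarrow> 2 * (q ^ ?e m * (q ^ 7) ^ ?e n))"
      unfolding j unfolding p(1) prod.case eqn by (simp only: mult.assoc)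
  next
    fix p :: "int \<times> int"
    obtain k l where p: "p = (k, l)"
      by fastforce
    let ?i = "\<lambda>(k, l). if even (k + l) then ((k - 7 * l) div 2 - 1, (k + l) div 2)
                    else ((7 * l - k + 1) div 2, - ((k + l + 1) div 2))"
    let ?j = "\<lambda>(m, n). if (n - m) mod 4 = 1 then ((7 * n + m + 1) div 4, (n - m - 1) div 4)
                    else (- ((7 * n + m + 3) div 4), (m - n - 1) div 4)"
    have H: "?i p \<in> {(m, n). odd (m + n)} \<and> ?j (?i p) = p"
    proof (cases "even (k + l)")
      case True
      then obtain c where "k + l = 2 * c"
        by (elim evenE)
      then have k: "k = 2 * c - l"
        by simp
      have "(k - 7 * l) div 2 - 1 = c - 4 * l - 1" "(k + l) div 2 = c"
        unfolding k by presburger+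
      then have i: "?i p = (c - 4 * l - 1, c)"
        using True unfolding p by (simp only: prod.case if_True simp_thms)
      have "(c - (c - 4 * l - 1)) mod 4 = 1" "(7 * c + (c - 4 * l - 1) + 1) div 4 = 2 * c - l"
        "(c - (c - 4 * l - 1) - 1) div 4 = l"
        by presburger+
      then have "?j (?i p) = p"
        unfolding i unfolding p k by (simp only: prod.case if_True simp_thms)
      moreover have "odd (c - 4 * l - 1 + c)"
        by presburger
      ultimately show ?thesis
        unfolding i by blast
    next
      case False
      then obtain c where "k + l = 2 * c + 1"
        by (elim oddE)
      then have k: "k = 2 * c + 1 - l"
        by simp
      have "(7 * l - k + 1) div 2 = 4 * l - c" "- ((k + l + 1) div 2) = - c - 1"
        unfolding k by presburger+
      then have i: "?i p = (4 * l - c, - c - 1)"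
        using False unfolding p by (simp only: prod.case if_False simp_thms)
      have "(- c - 1 - (4 * l - c)) mod 4 \<noteq> 1" "- ((7 * (- c - 1) + (4 * l - c) + 3) div 4) = 2 * c + 1 - l"
        "(4 * l - c - (- c - 1) - 1) div 4 = l"
        by presburger+
      then have "?j (?i p) = p"
        unfolding i unfolding p k by (simp only: prod.case if_False simp_thms)
      moreover have "odd (4 * l - c + (- c - 1))"
        by presburger
      ultimately show ?thesis
        unfolding i by blast
    qed
    show "?i p \<in> {(m, n). odd (m + n)}"
      by (rule conjunct1[OF H])
    show "?j (?i p) = p"
      by (rule conjunct2[OF H])
  qed auto
  finally have "((\<lambda>(k, l). 2 * q * ((q\<^sup>2) ^ ?e k * (q ^ 14) ^ ?e l)) has_sum ?L) UNIV" .
  moreover have "((\<lambda>p. 2 * q * (case p of (k, l) \<Rightarrow> (q\<^sup>2) ^ ?e k * (q ^ 14) ^ ?e l)) has_sum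
      2 * q * (ramanujan_psi (q\<^sup>2) * ramanujan_psi (q ^ 14))) UNIV"
    using assms n by (intro has_sum_cmult_right prod) auto
  ultimately have "?L = 2 * q * (ramanujan_psi (q\<^sup>2) * ramanujan_psi (q ^ 14))"
    by (intro has_sum_unique) (auto simp: case_prod_unfold)
  then show ?thesis
    by (simp add: mult.assoc)
qed

subsection \<open>The differential equation of the modular lambda function\<close>

text \<open>In Jacobi's series the indices - 2 m and 2 m + 1 share an exponent, and their
  coefficients 2 m and 2 m + 1 add up to 4 m + 1. The exponents thereby become those of psi.\<close>

lemma eulerE_cube:
  assumes q: "norm q < 1" "q \<noteq> 0"
  shows "((\<lambda>m. of_int (4 * m + 1) * q ^ nat (2 * m\<^sup>2 + m)) has_sum eulerE q ^ 3) UNIV"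
    and "(\<lambda>m. norm (of_int (4 * m + 1) * q ^ nat (2 * m\<^sup>2 + m))) summable_on UNIV"
proof -
  define f where "f i = - (of_int i * (- 1) powi i * q powi (i * (i - 1) div 2))" for i
  have n: "(\<lambda>i. norm (f i)) summable_on UNIV"
    using theta_deriv_abs_summable[OF q, of "- 1"] by (simp add: f_def)
  have fs: "(f has_sum eulerE q ^ 3) UNIV"
    using has_sum_infsum[OF abs_summable_summable[OF n]]
    unfolding jacobi_cube[OF q] f_def infsum_uminus by simp
  have g0: "f (- 2 * m) = of_int (2 * m) * q ^ nat (2 * m\<^sup>2 + m)" for m
  proof -
    have "(- 2 * m) * (- 2 * m - 1) = 2 * (2 * m\<^sup>2 + m)"
      by (simp add: power2_eq_square algebra_simps)
    then have "(- 2 * m) * (- 2 * m - 1) div 2 = 2 * m\<^sup>2 + m"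
      by simp
    then show ?thesis
      unfolding f_def using two_msq_nonneg[of m]
      by (simp add: power_int_nonneg_exp power_int_minus_left)
  qed
  have g1: "f (2 * m + 1) = of_int (2 * m + 1) * q ^ nat (2 * m\<^sup>2 + m)" for m
  proof -
    have "(2 * m + 1) * (2 * m + 1 - 1) = 2 * (2 * m\<^sup>2 + m)"
      by (simp add: power2_eq_square algebra_simps)
    then have "(2 * m + 1) * (2 * m + 1 - 1) div 2 = 2 * m\<^sup>2 + m"
      by simp
    then show ?thesis
      unfolding f_def using two_msq_nonneg[of m]
      by (simp add: power_int_nonneg_exp power_int_minus_left algebra_simps)
  qed
  have sum: "of_int (4 * m + 1) * q ^ nat (2 * m\<^sup>2 + m) = f (- 2 * m) + f (2 * m + 1)" for m
    unfolding g0 g1 by (simp add: algebra_simps)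
  have i0: "inj (\<lambda>m::int. - 2 * m)" and i1: "inj (\<lambda>m::int. 2 * m + 1)"
    by (auto simp: inj_on_def)
  have n0: "(\<lambda>m. norm (f (- 2 * m))) summable_on UNIV"
    using summable_on_subset_banach[OF n subset_UNIV, of "range (\<lambda>m. - 2 * m)"]
    unfolding summable_on_reindex[OF i0] o_def .
  have n1: "(\<lambda>m. norm (f (2 * m + 1))) summable_on UNIV"
    using summable_on_subset_banach[OF n subset_UNIV, of "range (\<lambda>m. 2 * m + 1)"]
    unfolding summable_on_reindex[OF i1] o_def .
  show "(\<lambda>m. norm (of_int (4 * m + 1) * q ^ nat (2 * m\<^sup>2 + m))) summable_on UNIV"
  proof (rule summable_on_comparison_test[OF summable_on_add[OF n0 n1]])
    show "norm (of_int (4 * m + 1) * q ^ nat (2 * m\<^sup>2 + m)) \<le> norm (f (- 2 * m)) + norm (f (2 * m + 1))" for m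
      unfolding sum by (rule norm_triangle_ineq)
  qed auto
  have s0: "((\<lambda>m. f (- 2 * m)) has_sum (\<Sum>\<^sub>\<infinity>m. f (- 2 * m))) UNIV"
    by (rule has_sum_infsum[OF abs_summable_summable[OF n0]])
  have s1: "((\<lambda>m. f (2 * m + 1)) has_sum (\<Sum>\<^sub>\<infinity>m. f (2 * m + 1))) UNIV"
    by (rule has_sum_infsum[OF abs_summable_summable[OF n1]])
  have r0: "(f has_sum (\<Sum>\<^sub>\<infinity>m. f (- 2 * m))) (range (\<lambda>m. - 2 * m))"
    using s0 unfolding has_sum_reindex[OF i0] o_def .
  have r1: "(f has_sum (\<Sum>\<^sub>\<infinity>m. f (2 * m + 1))) (range (\<lambda>m. 2 * m + 1))"
    using s1 unfolding has_sum_reindex[OF i1] o_def .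
  have disj: "range (\<lambda>m. - 2 * m) \<inter> range (\<lambda>m. 2 * m + 1) = ({} :: int set)"
  proof -
    have "- 2 * m \<noteq> 2 * k + 1" for m k :: int
      by presburger
    then show ?thesis
      by blast
  qed
  have cover: "range (\<lambda>m. - 2 * m) \<union> range (\<lambda>m. 2 * m + 1) = (UNIV :: int set)"
  proof -
    have "i \<in> range (\<lambda>m. - 2 * m) \<union> range (\<lambda>m. 2 * m + 1)" for i :: int
    proof (cases "even i")
      case True
      then obtain k where "i = 2 * k"
        by (elim evenE)
      then have "i = - 2 * (- k)"
        by simp
      then show ?thesis
        by (blast intro: range_eqI)
    next
      case False
      then show ?thesis
        by (auto elim!: oddE)
    qed
    then show ?thesis
      by blast
  qed
  have "eulerE q ^ 3 = (\<Sum>\<^sub>\<infinity>m. f (- 2 * m)) + (\<Sum>\<^sub>\<infinity>m. f (2 * m + 1))"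
    using has_sum_Un_disjoint[OF r0 r1 disj] unfolding cover by (rule has_sum_unique[OF fs])
  then show "((\<lambda>m. of_int (4 * m + 1) * q ^ nat (2 * m\<^sup>2 + m)) has_sum eulerE q ^ 3) UNIV"
    unfolding sum using has_sum_add[OF s0 s1] by simp
qed

lemma nat_sum_cong:
  assumes "a + b = c + d" "a \<ge> 0" "b \<ge> 0" "c \<ge> 0" "d \<ge> (0 :: int)"
  shows "nat a + nat b = nat c + nat d"
  using assms by linarith

text \<open>With \<open>a = 4 m + 1\<close>, \<open>b = 4 n + 1\<close> the sixth power is the sum of \<open>a b q\<close> raised to
  \<open>(a\<^sup>2 + b\<^sup>2 - 2) / 8\<close>; in the variables \<open>(a + b) / 2\<close> and \<open>(a - b) / 2\<close> the factor \<open>a b\<close>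
  becomes a difference of squares, so the sum is a Wronskian of theta functions.\<close>

lemma eulerE_pow6_has_sum:
  assumes q: "norm q < 1" "q \<noteq> 0"
  shows "((\<lambda>(M, V). of_int ((4 * M + 1)\<^sup>2 - 4 * V\<^sup>2) * (q ^ nat (4 * M\<^sup>2 + 2 * M) * q ^ nat (V\<^sup>2)))
    has_sum eulerE q ^ 6) UNIV"
proof -
  let ?e = "\<lambda>m::int. nat (2 * m\<^sup>2 + m)"
  have inf: "(\<Sum>\<^sub>\<infinity>m. of_int (4 * m + 1) * q ^ ?e m) = eulerE q ^ 3"
    by (rule infsumI[OF eulerE_cube(1)[OF q]])
  have "((\<lambda>(m, n). of_int (4 * m + 1) * q ^ ?e m * (of_int (4 * n + 1) * q ^ ?e n)) has_sum
      eulerE q ^ 3 * eulerE q ^ 3) UNIV"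
    using has_sum_mult_Times[OF eulerE_cube(2)[OF q] eulerE_cube(2)[OF q]] unfolding inf .
  \<comment> \<open>Here (a - b) / 2 = 2 V with V = m - n, while (a + b) / 2 = 2 (m + n) + 1 is 1 or
    3 modulo 4 as V is even or odd. In the odd case its negative is written as 4 M + 1, which leaves
    the square unchanged.\<close>
  also have "?this \<longleftrightarrow> ((\<lambda>(M, V). of_int ((4 * M + 1)\<^sup>2 - 4 * V\<^sup>2) * (q ^ nat (4 * M\<^sup>2 + 2 * M) * q ^ nat (V\<^sup>2)))
    has_sum eulerE q ^ 6) UNIV"
  proof (rule has_sum_reindex_bij_witness[symmetric, where
      i = "\<lambda>(m, n). (if even (m - n) then (m + n) div 2 else - ((m + n + 1) div 2), m - n)" and
      j = "\<lambda>(M, V). if even V then (M + V div 2, M - V div 2) else (V div 2 - M, - M - 1 - V div 2)"])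
    fix p :: "int \<times> int"
    let ?i = "\<lambda>(m, n). (if even (m - n) then (m + n) div 2 else - ((m + n + 1) div 2), m - n)"
    let ?j = "\<lambda>(M, V). if even V then (M + V div 2, M - V div 2) else (V div 2 - M, - M - 1 - V div 2)"
    let ?F = "\<lambda>(m, n). of_int (4 * m + 1) * q ^ ?e m * (of_int (4 * n + 1) * q ^ ?e n)"
    let ?G = "\<lambda>(M, V). of_int ((4 * M + 1)\<^sup>2 - 4 * V\<^sup>2) * (q ^ nat (4 * M\<^sup>2 + 2 * M) * q ^ nat (V\<^sup>2))"
    obtain M V where p: "p = (M, V)"
      by fastforce
    have FG: "?F (m, n) = ?G (M, V)"
      if "(4 * m + 1) * (4 * n + 1) = (4 * M + 1)\<^sup>2 - 4 * V\<^sup>2"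
        "(2 * m\<^sup>2 + m) + (2 * n\<^sup>2 + n) = (4 * M\<^sup>2 + 2 * M) + V\<^sup>2" for m n
    proof -
      have "?e m + ?e n = nat (4 * M\<^sup>2 + 2 * M) + nat (V\<^sup>2)"
        using that(2) two_msq_nonneg[of m] two_msq_nonneg[of n] two_msq_nonneg[of M]
        by (intro nat_sum_cong) auto
      then have "q ^ ?e m * q ^ ?e n = q ^ nat (4 * M\<^sup>2 + 2 * M) * q ^ nat (V\<^sup>2)"
        by (simp only: power_add[symmetric])
      moreover have "?F (m, n) = of_int ((4 * m + 1) * (4 * n + 1)) * (q ^ ?e m * q ^ ?e n)"
        by (simp only: prod.case of_int_mult mult_ac)
      ultimately show ?thesis
        unfolding that(1) by (simp only: prod.case)
    qed
    have "?i (?j p) = p \<and> ?F (?j p) = ?G p"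
    proof (cases "even V")
      case True
      then obtain c where V: "V = 2 * c"
        by (elim evenE)
      have j: "?j p = (M + c, M - c)"
        unfolding p V by simp
      have "?i (M + c, M - c) = p"
        unfolding p V by simp
      moreover have "?F (M + c, M - c) = ?G p"
        unfolding p by (rule FG) (simp_all add: V power2_eq_square algebra_simps)
      ultimately show ?thesis
        unfolding j by blast
    next
      case False
      then obtain c where V: "V = 2 * c + 1"
        by (elim oddE)
      have j: "?j p = (c - M, - M - 1 - c)"
        unfolding p V by simp
      have "c - M - (- M - 1 - c) = 2 * c + 1" "c - M + (- M - 1 - c) + 1 = 2 * (- M)"
        by simp_all
      then have "?i (c - M, - M - 1 - c) = p"
        unfolding p V by (simp only: prod.case) simp
      moreover have "?F (c - M, - M - 1 - c) = ?G p"
        unfolding p by (rule FG) (simp_all add: V power2_eq_square algebra_simps)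
      ultimately show ?thesis
        unfolding j by blast
    qed
    then show "?i (?j p) = p" "?F (?j p) = ?G p"
      by blast+
  next
    fix p :: "int \<times> int"
    let ?i = "\<lambda>(m, n). (if even (m - n) then (m + n) div 2 else - ((m + n + 1) div 2), m - n)"
    let ?j = "\<lambda>(M, V). if even V then (M + V div 2, M - V div 2) else (V div 2 - M, - M - 1 - V div 2)"
    obtain m n where p: "p = (m, n)"
      by fastforce
    show "?j (?i p) = p"
    proof (cases "even (m - n)")
      case True
      then obtain c where "m - n = 2 * c"
        by (elim evenE)
      then have m: "m = n + 2 * c"
        by simp
      have "?i p = (n + c, 2 * c)"
        unfolding p m by simp
      then show ?thesis
        by (simp add: p m)
    next
      case False
      then obtain c where "m - n = 2 * c + 1"
        by (elim oddE)
      then have m: "m = n + 2 * c + 1"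
        by simp
      have "?i p = (- (n + c + 1), 2 * c + 1)"
        unfolding p m by simp
      then show ?thesis
        by (simp add: p m)
    qed
  qed (auto simp: power_add[symmetric])
  finally show ?thesis .
qed


text \<open>In classical notation this is theta_2^4 / theta_3^4 at nome q, since theta_2 = 2 q^(1/4)
  psi(q^2); the fourth power removes the fractional power of q.\<close>

definition modular_alpha :: "complex \<Rightarrow> complex" where
  "modular_alpha q = 16 * q * ramanujan_psi (q\<^sup>2) ^ 4 / ramanujan_phi q ^ 4"

lemma phi_nonzero:
  assumes "norm q < 1" "q \<noteq> 0"
  shows "ramanujan_phi q \<noteq> 0"
  using assms eulerE_nonzero norm_power_less_one[OF assms(1)] by (simp add: phi_eq)

lemma one_minus_modular_alpha:
  assumes "norm q < 1" "q \<noteq> 0"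
  shows "1 - modular_alpha q = ramanujan_phi (- q) ^ 4 / ramanujan_phi q ^ 4"
proof -
  have "1 - modular_alpha q =
      (ramanujan_phi q ^ 4 - 16 * q * ramanujan_psi (q\<^sup>2) ^ 4) / ramanujan_phi q ^ 4"
    using phi_nonzero[OF assms] by (simp add: modular_alpha_def diff_divide_distrib)
  also have "ramanujan_phi q ^ 4 - 16 * q * ramanujan_psi (q\<^sup>2) ^ 4 = ramanujan_phi (- q) ^ 4"
    using jacobi_quartic[OF assms] by simp
  finally show ?thesis .
qed

lemma psi_sq_exponent: "(q\<^sup>2) ^ nat (2 * i\<^sup>2 + i) = q ^ nat (4 * i\<^sup>2 + 2 * i)" for q :: complex
proof -
  have "nat (2 * x) = 2 * nat x" for x
    by simp
  from this[of "2 * i\<^sup>2 + i"] have "nat (4 * i\<^sup>2 + 2 * i) = 2 * nat (2 * i\<^sup>2 + i)"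
    by (simp add: algebra_simps)
  then show ?thesis
    by (simp add: power_mult)
qed

lemma psi_sq_abs_summable:
  fixes q :: complex
  assumes "norm q < 1" "q \<noteq> 0"
  shows "(\<lambda>i. norm (q ^ nat (4 * i\<^sup>2 + 2 * i))) summable_on UNIV"
  using psi_abs_summable[of "q\<^sup>2"] assms norm_power_less_one[OF assms(1), of 2]
  unfolding psi_sq_exponent by simp

text \<open>The weight (4 M + 1)^2 - 4 V^2 is 1 + 4 (a - b), where a = 4 M^2 + 2 M and b = V^2 are
  the exponents in psi(q^2) and phi(q). Such a weight is produced by q d/dq; the summand 1 reflects
  the q^(1/4) missing from psi(q^2).\<close>

lemma theta_wronskian:
  assumes q: "norm q < 1" "q \<noteq> 0"
  obtains \<phi>' \<psi>' where "(ramanujan_phi has_field_derivative \<phi>') (at q)"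
    "((\<lambda>q. ramanujan_psi (q\<^sup>2)) has_field_derivative \<psi>') (at q)"
    "ramanujan_psi (q\<^sup>2) * ramanujan_phi q + 4 * q * (\<psi>' * ramanujan_phi q - ramanujan_psi (q\<^sup>2) * \<phi>') = eulerE q ^ 6"
proof -
  define a where "a M = nat (4 * M\<^sup>2 + 2 * M)" for M :: int
  define b where "b V = nat (V\<^sup>2)" for V :: int
  have psi: "ramanujan_psi (x\<^sup>2) = (\<Sum>\<^sub>\<infinity>i. x ^ a i)" for x
    unfolding ramanujan_psi_def psi_sq_exponent a_def ..
  have phi: "ramanujan_phi x = (\<Sum>\<^sub>\<infinity>i. x ^ b i)" for x
    unfolding ramanujan_phi_def b_def ..
  have na: "(\<lambda>i. norm (x ^ a i)) summable_on UNIV" if "norm x < 1" "x \<noteq> 0" for x :: complex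
    unfolding a_def by (rule psi_sq_abs_summable[OF that])
  have nb: "(\<lambda>i. norm (x ^ b i)) summable_on UNIV" if "norm x < 1" "x \<noteq> 0" for x :: complex
    unfolding b_def by (rule phi_abs_summable[OF that])
  note da = power_series_deriv[OF na q] and db = power_series_deriv[OF nb q]
  let ?A = "\<Sum>\<^sub>\<infinity>i. of_nat (a i) * q ^ a i" and ?B = "\<Sum>\<^sub>\<infinity>i. of_nat (b i) * q ^ b i"
  have "((\<lambda>p. (case p of (M, V) \<Rightarrow> q ^ a M * q ^ b V) +
      4 * ((case p of (M, V) \<Rightarrow> of_nat (a M) * q ^ a M * q ^ b V) +
        - (case p of (M, V) \<Rightarrow> q ^ a M * (of_nat (b V) * q ^ b V)))) has_sum
      ramanujan_psi (q\<^sup>2) * ramanujan_phi q + 4 * (?A * ramanujan_phi q + - (ramanujan_psi (q\<^sup>2) * ?B))) UNIV"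
    unfolding psi phi
    by (intro has_sum_add has_sum_cmult_right has_sum_uminusI has_sum_mult_Times na[OF q] nb[OF q] da(1) db(1))
  also have "?this \<longleftrightarrow> ((\<lambda>(M, V). of_int ((4 * M + 1)\<^sup>2 - 4 * V\<^sup>2) * (q ^ a M * q ^ b V)) has_sum
      ramanujan_psi (q\<^sup>2) * ramanujan_phi q + 4 * (?A * ramanujan_phi q + - (ramanujan_psi (q\<^sup>2) * ?B))) UNIV"
  proof (rule has_sum_cong)
    fix p :: "int \<times> int"
    obtain M V where p: "p = (M, V)"
      by fastforce
    have "(4 * M\<^sup>2 + 2 * M) \<ge> 0"
      using two_msq_nonneg[of M] by simp
    then have "(of_nat (a M) :: complex) = of_int (4 * M\<^sup>2 + 2 * M)" "(of_nat (b V) :: complex) = of_int (V\<^sup>2)"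
      unfolding a_def b_def by (simp_all add: of_nat_nat del: of_int_add of_int_mult)
    then show "(case p of (M, V) \<Rightarrow> q ^ a M * q ^ b V) +
      4 * ((case p of (M, V) \<Rightarrow> of_nat (a M) * q ^ a M * q ^ b V) +
        - (case p of (M, V) \<Rightarrow> q ^ a M * (of_nat (b V) * q ^ b V))) =
      (case p of (M, V) \<Rightarrow> of_int ((4 * M + 1)\<^sup>2 - 4 * V\<^sup>2) * (q ^ a M * q ^ b V))"
      unfolding p by (simp add: power2_eq_square algebra_simps)
  qed
  finally have "ramanujan_psi (q\<^sup>2) * ramanujan_phi q + 4 * (?A * ramanujan_phi q + - (ramanujan_psi (q\<^sup>2) * ?B)) = eulerE q ^ 6"
    using eulerE_pow6_has_sum[OF q] unfolding a_def b_def by (rule has_sum_unique)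
  then have "ramanujan_psi (q\<^sup>2) * ramanujan_phi q +
      4 * q * (?A / q * ramanujan_phi q - ramanujan_psi (q\<^sup>2) * (?B / q)) = eulerE q ^ 6"
    using q by (simp add: algebra_simps)
  moreover have "(ramanujan_phi has_field_derivative ?B / q) (at q)"
    using db(2) unfolding phi[symmetric] .
  moreover have "((\<lambda>q. ramanujan_psi (q\<^sup>2)) has_field_derivative ?A / q) (at q)"
    using da(2) unfolding psi[symmetric] .
  ultimately show ?thesis
    using that by blast
qed

text \<open>The quotient rule leaves 16 p^3 f^3 times the Wronskian, hence times the sixth power of
  \<open>eulerE q\<close>. As an Euler quotient that power is p f phi(- q)^4, which supplies the
  factor 1 - alpha.\<close>

lemma modular_alpha_has_deriv:
  assumes q: "norm q < 1" "q \<noteq> 0"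
  shows "(modular_alpha has_field_derivative
    modular_alpha q * (1 - modular_alpha q) * ramanujan_phi q ^ 4 / q) (at q)"
proof -
  obtain \<phi>' \<psi>' where d: "(ramanujan_phi has_field_derivative \<phi>') (at q)"
    "((\<lambda>q. ramanujan_psi (q\<^sup>2)) has_field_derivative \<psi>') (at q)" and
    w: "ramanujan_psi (q\<^sup>2) * ramanujan_phi q + 4 * q * (\<psi>' * ramanujan_phi q - ramanujan_psi (q\<^sup>2) * \<phi>') = eulerE q ^ 6"
    using theta_wronskian[OF q] by blast
  define p f where "p = ramanujan_psi (q\<^sup>2)" and "f = ramanujan_phi q"
  have f0: "f \<noteq> 0"
    unfolding f_def by (rule phi_nonzero[OF q])
  have n: "norm (q\<^sup>2) < 1"
    using norm_power_less_one[OF q(1)] by simp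
  have "(modular_alpha has_field_derivative
      ((16 * p ^ 4 + 16 * q * (4 * p ^ 3 * \<psi>')) * f ^ 4 - 16 * q * p ^ 4 * (4 * f ^ 3 * \<phi>')) / (f ^ 4 * f ^ 4)) (at q)"
    unfolding modular_alpha_def p_def f_def using f0
    by (auto intro!: derivative_eq_intros d simp: f_def)
  also have "((16 * p ^ 4 + 16 * q * (4 * p ^ 3 * \<psi>')) * f ^ 4 - 16 * q * p ^ 4 * (4 * f ^ 3 * \<phi>')) / (f ^ 4 * f ^ 4) =
      16 * p ^ 3 * f ^ 3 * (p * f + 4 * q * (\<psi>' * f - p * \<phi>')) / (f ^ 4 * f ^ 4)"
    by (simp add: eval_nat_numeral algebra_simps)
  also have "\<dots> = 16 * p ^ 3 * f ^ 3 * eulerE q ^ 6 / (f ^ 4 * f ^ 4)"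
    unfolding w[folded p_def f_def] ..
  also have "\<dots> = 16 * q * p ^ 4 / f ^ 4 * (ramanujan_phi (- q) ^ 4 / f ^ 4) * f ^ 4 / q"
  proof -
    have E0: "eulerE q \<noteq> 0" "eulerE (q\<^sup>2) \<noteq> 0"
      using eulerE_nonzero q n by auto
    have pf: "p * f = (eulerE (q\<^sup>2) ^ 2 / eulerE q) ^ 2"
      using phi_mult_psi_sq[OF q] unfolding p_def f_def psi_eq[OF q] by (simp add: mult.commute)
    have "p * f * (ramanujan_phi (- q)) ^ 4 = eulerE q ^ 6"
      unfolding pf phi_neg_eq[OF q] using E0 by (simp add: power_divide flip: power_mult) (simp add: eval_nat_numeral)
    then have "16 * p ^ 3 * f ^ 3 * eulerE q ^ 6 = 16 * p ^ 3 * f ^ 3 * (p * f * (ramanujan_phi (- q)) ^ 4)"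
      by simp
    also have "\<dots> = 16 * p ^ 4 * f ^ 4 * ramanujan_phi (- q) ^ 4"
      by (simp add: eval_nat_numeral)
    finally show ?thesis
      using q f0 by simp
  qed
  moreover have "modular_alpha q = 16 * q * p ^ 4 / f ^ 4"
    by (simp add: modular_alpha_def p_def f_def)
  ultimately show ?thesis
    unfolding one_minus_modular_alpha[OF q] f_def[symmetric] by (simp only:)
qed

subsection \<open>Algebra of the modular equation of degree seven\<close>

text \<open>For alpha = a and beta = b, \<sigma> is a + b, and a, b are the roots of y^2 - \<sigma>
  y + x^8. The first identity evaluates a (1 - a) + b (1 - b). The second is the multiplier formula
  cleared of denominators, modulo that quadratic; its bracket is the quotient on division by the
  quadratic in b.\<close>

lemma degree7_curve_identity:
  fixes x b :: complex
  assumes t: "t = x * (1 - x)" and S: "S = 4 * t\<^sup>2 - 7 * t + 2" and \<sigma>: "\<sigma> = 1 + x ^ 8 - (1 - x) ^ 8"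
  shows "\<sigma> - \<sigma>\<^sup>2 + 2 * x ^ 8 = t * S ^ 3 - 3 * t ^ 3 * S"
    and "7 * (b - x) * t\<^sup>2 * (S\<^sup>2 - t\<^sup>2)
      - (x - \<sigma> + b) * ((1 + 4 * t) * t\<^sup>2 * (S\<^sup>2 - t\<^sup>2) + 8 * t * (3 - 2 * t) * (b * (1 - b) + S * t ^ 3))
      = (- 16 * x ^ 5 - 16 * x ^ 4 * b + 48 * x ^ 4 + 32 * x ^ 3 * b - 72 * x ^ 3 - 40 * x\<^sup>2 * b
          + 64 * x\<^sup>2 + 24 * x * b - 24 * x) * (b\<^sup>2 - \<sigma> * b + x ^ 8)"
  unfolding \<sigma> S t by algebra+

text \<open>The non-vanishing hypotheses select the branch: the first three relations determine
  \<open>v + 1 / v\<close> only up to the roots of a cubic.\<close>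

lemma degree7_algebra:
  fixes x a b v m :: complex
  defines "t \<equiv> x * (1 - x)"
  defines "s \<equiv> 4 * t + 2 / t - 7"
  defines "V \<equiv> v + 1 / v"
  assumes ab: "a * b = x ^ 8" "(1 - a) * (1 - b) = (1 - x) ^ 8"
    and v3: "v ^ 3 * t ^ 4 = b * (1 - b)"
    and m: "(x - a) * m = 7 * (b - x)"
    and nz: "t \<noteq> 0" "v \<noteq> 0" "x \<noteq> a" "V\<^sup>2 + V * s + s\<^sup>2 \<noteq> 3" "s\<^sup>2 \<noteq> 1"
  shows "V = s" and "m = 1 + 4 * t + 8 * t * (3 - 2 * t) * v"
proof -
  define S where "S = 4 * t\<^sup>2 - 7 * t + 2"
  define \<sigma> where "\<sigma> = 1 + x ^ 8 - (1 - x) ^ 8"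
  have S: "S = t * s"
    using nz(1) by (simp add: S_def s_def field_simps power2_eq_square)
  have \<sigma>: "a + b = \<sigma>"
    using ab unfolding \<sigma>_def by (simp add: algebra_simps)
  have a: "a = \<sigma> - b"
    using \<sigma> by (simp add: algebra_simps)
  have g: "b\<^sup>2 - \<sigma> * b + x ^ 8 = 0"
    using ab(1) unfolding a by (simp add: power2_eq_square algebra_simps)
  note id = degree7_curve_identity[OF meta_eq_to_obj_eq[OF t_def] S_def \<sigma>_def]
  have prod: "(a * (1 - a)) * (b * (1 - b)) = t ^ 8"
  proof -
    have "(a * (1 - a)) * (b * (1 - b)) = (a * b) * ((1 - a) * (1 - b))"
      by (simp add: mult_ac)
    then show ?thesis
      unfolding ab t_def by (simp add: power_mult_distrib)
  qed
  \<comment> \<open>Companion of \<open>v3\<close>: v^3 and 1 / v^3 are b (1 - b) and a (1 - a),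
    each over t^4, so their sum is symmetric in a and b and depends on x only.\<close>
  have v3': "v ^ 3 * (a * (1 - a)) = t ^ 4"
  proof -
    have "t ^ 4 * (v ^ 3 * (a * (1 - a))) = (a * (1 - a)) * (v ^ 3 * t ^ 4)"
      by (simp only: mult_ac)
    also have "\<dots> = t ^ 4 * t ^ 4"
      unfolding v3 prod by (simp flip: power_add)
    finally have eq: "t ^ 4 * (v ^ 3 * (a * (1 - a))) = t ^ 4 * t ^ 4" .
    have "t ^ 4 \<noteq> 0"
      using nz(1) by simp
    then show ?thesis
      using eq by (rule mult_left_cancel[THEN iffD1])
  qed
  have "t ^ 4 * (v ^ 6 + 1) = v ^ 3 * (b * (1 - b) + a * (1 - a))"
  proof -
    have "t ^ 4 * (v ^ 6 + 1) = v ^ 3 * (v ^ 3 * t ^ 4) + t ^ 4"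
      by (simp add: algebra_simps flip: power_add)
    also have "\<dots> = v ^ 3 * (b * (1 - b)) + v ^ 3 * (a * (1 - a))"
      unfolding v3 v3' ..
    finally show ?thesis
      by (simp add: algebra_simps)
  qed
  also have "b * (1 - b) + a * (1 - a) = \<sigma> - \<sigma>\<^sup>2 + 2 * x ^ 8"
    unfolding \<sigma>[symmetric] ab(1)[symmetric] by (simp add: power2_eq_square algebra_simps)
  also have "\<dots> = t ^ 4 * (s ^ 3 - 3 * s)"
    unfolding id(1) S by (simp add: eval_nat_numeral algebra_simps)
  finally have "t ^ 4 * (v ^ 6 + 1) = t ^ 4 * (v ^ 3 * (s ^ 3 - 3 * s))"
    by (simp only: mult_ac)
  then have v6: "v ^ 6 + 1 = v ^ 3 * (s ^ 3 - 3 * s)"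
    using nz(1) by simp
  \<comment> \<open>V^3 - 3 V is v^3 + 1 / v^3, so V and s take the same value under y^3 - 3
    y.\<close>
  have "v ^ 3 * (V ^ 3 - 3 * V) = v ^ 6 + 1"
    using nz(2) by (simp add: V_def eval_nat_numeral field_simps)
  then have "V ^ 3 - 3 * V = s ^ 3 - 3 * s"
    using v6 nz(2) by simp
  then have "(V - s) * (V\<^sup>2 + V * s + s\<^sup>2 - 3) = 0"
    by (simp add: eval_nat_numeral algebra_simps)
  then show Vs: "V = s"
    using nz(4) by simp
  \<comment> \<open>Reducing v^3 by this quadratic makes it linear in v with coefficient s^2 - 1. As
    s^2 differs from 1, v can be recovered from v^3, that is, from b.\<close>
  have v2: "v\<^sup>2 = s * v - 1"
    using Vs nz(2) unfolding V_def by (simp add: field_simps power2_eq_square)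
  have "v ^ 3 = v * v\<^sup>2"
    by (simp add: eval_nat_numeral)
  also have "\<dots> = (s\<^sup>2 - 1) * v - s"
    unfolding v2 by (simp add: algebra_simps) (simp add: v2 power2_eq_square[symmetric] algebra_simps)
  finally have v3s: "(s\<^sup>2 - 1) * v = v ^ 3 + s"
    by simp
  let ?c = "1 + 4 * t" and ?d = "8 * t * (3 - 2 * t)"
  have "7 * (b - x) * t\<^sup>2 * (S\<^sup>2 - t\<^sup>2) =
      (x - a) * (?c * t\<^sup>2 * (S\<^sup>2 - t\<^sup>2) + ?d * (b * (1 - b) + S * t ^ 3))"
    using id(2)[of b] unfolding g a by (simp add: algebra_simps)
  also have "\<dots> = t ^ 4 * ((x - a) * (?c * (s\<^sup>2 - 1) + ?d * (v ^ 3 + s)))"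
    unfolding v3[symmetric] S by (simp add: eval_nat_numeral algebra_simps)
  also have "\<dots> = t ^ 4 * (s\<^sup>2 - 1) * ((x - a) * (?c + ?d * v))"
    unfolding v3s[symmetric] by (simp add: algebra_simps)
  also have "7 * (b - x) * t\<^sup>2 * (S\<^sup>2 - t\<^sup>2) = t ^ 4 * (s\<^sup>2 - 1) * ((x - a) * m)"
    unfolding m S by (simp add: eval_nat_numeral algebra_simps)
  finally show "m = ?c + ?d * v"
    using nz by simp
qed

text \<open>Replacing w by 1 / w exchanges y and z, fixes X and t, and sends PQ to 49 / PQ. So A is
  symmetric in y and z, hence a polynomial in X and t, and the quadratic for t reduces it to degree
  one in t.\<close>

lemma theorem3p3_algebra:
  fixes w t PQ X A :: complex
  defines "v \<equiv> 1 / w ^ 4"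
  assumes w: "w \<noteq> 0" and t: "t \<noteq> 0" and vt: "v + 1 / v = 4 * t + 2 / t - 7"
    and PQ: "PQ = w ^ 9 * (1 + 4 * t + 8 * t * (3 - 2 * t) * v)"
    and X: "X = w\<^sup>2 + (1 / w)\<^sup>2" and A: "A = PQ\<^sup>2 + (49 / PQ)\<^sup>2"
  shows "A ^ 2 = A * (X ^ 9 + 7 * X ^ 7 - 37 * X ^ 5 - 77 * X ^ 3 + 294 * X)
           - X ^ 12 - 20 * X ^ 10 - 86 * X ^ 8 - 2065 * X ^ 6 + 16317 * X ^ 4 - 22981 * X ^ 2"
proof -
  define y z where "y = w\<^sup>2" and "z = (1 / w)\<^sup>2"
  have yz: "y * z = 1"
    using w by (simp add: y_def z_def field_simps)
  have X: "X = y + z"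
    unfolding X y_def z_def ..
  have v: "v = z\<^sup>2" "1 / v = y\<^sup>2"
    unfolding v_def y_def z_def by (simp_all add: power_divide flip: power_mult)
  have vt': "t * (y\<^sup>2 + z\<^sup>2) = 4 * t\<^sup>2 + 2 - 7 * t"
  proof -
    have "t * (v + 1 / v) = 4 * t\<^sup>2 + 2 - 7 * t"
      unfolding vt using t by (simp add: field_simps power2_eq_square)
    then show ?thesis
      unfolding v(2) unfolding v(1) by (simp add: add.commute)
  qed
  have g: "4 * t\<^sup>2 - (5 + X\<^sup>2) * t + 2 = 0"
    using vt' yz unfolding X by algebra
  define c d where "c = 1 + 4 * t" and "d = 8 * t * (3 - 2 * t)"
  \<comment> \<open>The value of m at 1 / v is 49 / m; this is where the constant 49 in A comes
    from.\<close>
  have c49: "(c + d * z\<^sup>2) * (c + d * y\<^sup>2) = 49"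
    using vt' yz unfolding c_def d_def by algebra
  have PQ: "PQ = w ^ 9 * (c + d * z\<^sup>2)"
    unfolding PQ c_def d_def v ..
  have PQ0: "PQ \<noteq> 0"
    using c49 w unfolding PQ by auto
  have "49 / PQ = (1 / w) ^ 9 * (c + d * y\<^sup>2)"
  proof -
    have "PQ * ((1 / w) ^ 9 * (c + d * y\<^sup>2)) = (w * (1 / w)) ^ 9 * ((c + d * z\<^sup>2) * (c + d * y\<^sup>2))"
      unfolding PQ power_mult_distrib by (simp only: mult_ac)
    also have "\<dots> = 49"
      unfolding c49 using w by simp
    finally show ?thesis
      using PQ0 by (simp add: field_simps)
  qed
  then have "A = y ^ 9 * (c + d * z\<^sup>2)\<^sup>2 + z ^ 9 * (c + d * y\<^sup>2)\<^sup>2"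
    unfolding A PQ y_def z_def by (simp add: power_mult_distrib mult.commute flip: power_mult)
  also have "\<dots> = c\<^sup>2 * (y ^ 9 + z ^ 9) + 2 * (c * d) * (y ^ 7 + z ^ 7) + d\<^sup>2 * (y ^ 5 + z ^ 5)"
    using yz by algebra
  also have "y ^ 9 + z ^ 9 = X ^ 9 - 9 * X ^ 7 + 27 * X ^ 5 - 30 * X ^ 3 + 9 * X"
    using yz unfolding X by algebra
  also have "y ^ 7 + z ^ 7 = X ^ 7 - 7 * X ^ 5 + 14 * X ^ 3 - 7 * X"
    using yz unfolding X by algebra
  also have "y ^ 5 + z ^ 5 = X ^ 5 - 5 * X ^ 3 + 5 * X"
    using yz unfolding X by algebra
  also have "c\<^sup>2 = 4 * X\<^sup>2 * t + 28 * t - 7"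
    using g unfolding c_def by algebra
  also have "c * d = - 4 * X ^ 4 * t - 20 * X\<^sup>2 * t + 8 * X\<^sup>2 + 56 * t"
    using g unfolding c_def d_def by algebra
  also have "d\<^sup>2 = 4 * X ^ 6 * t + 12 * X ^ 4 * t - 8 * X ^ 4 - 100 * X\<^sup>2 * t + 16 * X\<^sup>2 + 84 * t + 56"
    using g unfolding d_def by algebra
  finally have A: "A = X ^ 9 - 4 * X ^ 7 * t + 7 * X ^ 7 - 8 * X ^ 5 * t - 29 * X ^ 5 + 124 * X ^ 3 * t
      - 102 * X ^ 3 - 112 * X * t + 217 * X"
    by algebra
  \<comment> \<open>If k is the coefficient of t in A, the left side is k^2 (t - t1) (t - t2) with
    t1, t2 the roots of the quadratic. Its leading coefficient being 4, the cofactor is k^2 /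
    4.\<close>
  have "A ^ 2 - (A * (X ^ 9 + 7 * X ^ 7 - 37 * X ^ 5 - 77 * X ^ 3 + 294 * X)
           - X ^ 12 - 20 * X ^ 10 - 86 * X ^ 8 - 2065 * X ^ 6 + 16317 * X ^ 4 - 22981 * X ^ 2) =
      (4 * X ^ 14 + 16 * X ^ 12 - 232 * X ^ 10 - 272 * X ^ 8 + 4292 * X ^ 6 - 6944 * X ^ 4 + 3136 * X\<^sup>2)
      * (4 * t\<^sup>2 - (5 + X\<^sup>2) * t + 2)"
    unfolding A by algebra
  then show ?thesis
    unfolding g by simp
qed

subsection \<open>The modular equation of degree seven near the cusp\<close>

lemma modular_alpha_eq:
  assumes "norm q < 1" "q \<noteq> 0"
  shows "modular_alpha q = 16 * q * eulerE q ^ 8 * eulerE (q ^ 4) ^ 16 / eulerE (q\<^sup>2) ^ 24"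
    and "1 - modular_alpha q = eulerE q ^ 16 * eulerE (q ^ 4) ^ 8 / eulerE (q\<^sup>2) ^ 24"
    and "ramanujan_phi q ^ 4 = eulerE (q\<^sup>2) ^ 20 / (eulerE q ^ 8 * eulerE (q ^ 4) ^ 8)"
proof -
  have n: "norm (q\<^sup>2) < 1" "norm (q ^ 4) < 1"
    using norm_power_less_one[OF assms(1)] by simp_all
  note nz = eulerE_nonzero[OF assms(1)] eulerE_nonzero[OF n(1)] eulerE_nonzero[OF n(2)]
  have psi: "ramanujan_psi (q\<^sup>2) = eulerE (q ^ 4) ^ 2 / eulerE (q\<^sup>2)"
    using psi_eq[OF n(1)] assms by (simp flip: power_mult)
  show phi: "ramanujan_phi q ^ 4 = eulerE (q\<^sup>2) ^ 20 / (eulerE q ^ 8 * eulerE (q ^ 4) ^ 8)"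
    unfolding phi_eq[OF assms] by (simp add: power_divide power_mult_distrib flip: power_mult)
  have "16 * q * (c\<^sup>2 / b) ^ 4 / (b ^ 20 / (a ^ 8 * c ^ 8)) = 16 * q * a ^ 8 * c ^ 16 / b ^ 24"
    if "b \<noteq> 0" for a b c :: complex
    using that by (simp add: power_divide divide_simps flip: power_mult power_add)
  from this[OF nz(2)] show "modular_alpha q = 16 * q * eulerE q ^ 8 * eulerE (q ^ 4) ^ 16 / eulerE (q\<^sup>2) ^ 24"
    unfolding modular_alpha_def psi phi .
  have "(a\<^sup>2 / b) ^ 4 / (b ^ 20 / (a ^ 8 * c ^ 8)) = a ^ 16 * c ^ 8 / b ^ 24"
    if "b \<noteq> 0" for a b c :: complex
    using that by (simp add: power_divide divide_simps flip: power_mult power_add)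
  from this[OF nz(2)] show "1 - modular_alpha q = eulerE q ^ 16 * eulerE (q ^ 4) ^ 8 / eulerE (q\<^sup>2) ^ 24"
    unfolding one_minus_modular_alpha[OF assms] phi_neg_eq[OF assms] phi .
qed

text \<open>The eighth root of alpha beta with leading term 2 q: all exponents in the Euler quotient
  of alpha beta are divisible by 8, so no branch has to be chosen.\<close>

definition deg7_x :: "complex \<Rightarrow> complex" where
  "deg7_x q = 2 * q * eulerE q * eulerE (q ^ 4) ^ 2 * eulerE (q ^ 7) * eulerE (q ^ 28) ^ 2
    / (eulerE (q\<^sup>2) ^ 3 * eulerE (q ^ 14) ^ 3)"

text \<open>Guetzlaff's equation in product form: divide \<open>psi_psi7_odd_part\<close> by psi(q)
  psi(q^7). The right side becomes x, and 1 - x is the same product of psi at negated arguments over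
  the one at q and q^7.\<close>

lemma one_minus_deg7_x:
  assumes "norm q < 1" "q \<noteq> 0"
  shows "1 - deg7_x q = eulerE q ^ 2 * eulerE (q ^ 4) * eulerE (q ^ 7) ^ 2 * eulerE (q ^ 28)
    / (eulerE (q\<^sup>2) ^ 3 * eulerE (q ^ 14) ^ 3)"
proof -
  have n: "norm (q ^ k) < 1" if "k > 0" for k
    using norm_power_less_one[OF assms(1) that] .
  have nz: "eulerE (q ^ k) \<noteq> 0" if "k > 0" for k
    using eulerE_nonzero[OF n[OF that]] .
  have nz1: "eulerE q \<noteq> 0"
    using eulerE_nonzero[OF assms(1)] .
  have psi_neg: "ramanujan_psi (- p) = eulerE p * eulerE (p ^ 4) / eulerE (p\<^sup>2)" if "norm p < 1" "p \<noteq> 0" for p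
  proof -
    have "norm (p\<^sup>2) < 1"
      using norm_power_less_one[OF that(1)] by simp
    then have "eulerE (p\<^sup>2) \<noteq> 0"
      by (rule eulerE_nonzero)
    then show ?thesis
      using psi_eq[of "- p"] that by (simp add: eulerE_neg) (simp add: eval_nat_numeral)
  qed
  have psi: "ramanujan_psi (q ^ k) = eulerE (q ^ (2 * k)) ^ 2 / eulerE (q ^ k)" if "k > 0" for k
    using psi_eq[OF n[OF that]] assms by (simp add: mult.commute flip: power_mult)
  have p7: "ramanujan_psi (- (q ^ 7)) = eulerE (q ^ 7) * eulerE (q ^ 28) / eulerE (q ^ 14)"
    using psi_neg[OF n[of 7]] assms by (simp flip: power_mult)
  have "eulerE (q\<^sup>2) ^ 2 / eulerE q * (eulerE (q ^ 14) ^ 2 / eulerE (q ^ 7))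
      - eulerE q * eulerE (q ^ 4) / eulerE (q\<^sup>2) * (eulerE (q ^ 7) * eulerE (q ^ 28) / eulerE (q ^ 14)) =
      2 * q * (eulerE (q ^ 4) ^ 2 / eulerE (q\<^sup>2)) * (eulerE (q ^ 28) ^ 2 / eulerE (q ^ 14))"
    using psi_psi7_odd_part[OF assms] psi[of 1] psi[of 7] psi[of 2] psi[of 14]
    unfolding psi_neg[OF assms] p7 by simp
  moreover have "1 - 2 * q * a * c ^ 2 * d * f ^ 2 / (b ^ 3 * e ^ 3) = a ^ 2 * c * d ^ 2 * f / (b ^ 3 * e ^ 3)"
    if "b ^ 2 / a * (e ^ 2 / d) - a * c / b * (d * f / e) = 2 * q * (c ^ 2 / b) * (f ^ 2 / e)"
      and "a \<noteq> 0" "b \<noteq> 0" "d \<noteq> 0" "e \<noteq> 0" for a b c d e f :: complex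
  proof -
    have "1 - 2 * q * a * c ^ 2 * d * f ^ 2 / (b ^ 3 * e ^ 3) =
        1 - a * d / (b ^ 2 * e ^ 2) * (2 * q * (c ^ 2 / b) * (f ^ 2 / e))"
      using that(2-) by (simp add: field_simps eval_nat_numeral)
    also have "\<dots> = a ^ 2 * c * d ^ 2 * f / (b ^ 3 * e ^ 3)"
      unfolding that(1)[symmetric] using that(2-) by (simp add: field_simps eval_nat_numeral)
    finally show ?thesis .
  qed
  ultimately show ?thesis
    unfolding deg7_x_def using nz nz1 by simp
qed

lemma deg7_alpha_mult:
  assumes "norm q < 1" "q \<noteq> 0"
  shows "modular_alpha q * modular_alpha (q ^ 7) = deg7_x q ^ 8"
    and "(1 - modular_alpha q) * (1 - modular_alpha (q ^ 7)) = (1 - deg7_x q) ^ 8"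
proof -
  have q7: "norm (q ^ 7) < 1" "q ^ 7 \<noteq> 0"
    using norm_power_less_one[OF assms(1)] assms by simp_all
  note a7 = modular_alpha_eq[OF q7, folded power_mult, simplified]
  show "modular_alpha q * modular_alpha (q ^ 7) = deg7_x q ^ 8"
    unfolding modular_alpha_eq(1)[OF assms] a7(1) deg7_x_def
    by (simp add: power_divide power_mult_distrib flip: power_mult power_Suc)
  show "(1 - modular_alpha q) * (1 - modular_alpha (q ^ 7)) = (1 - deg7_x q) ^ 8"
    unfolding modular_alpha_eq(2)[OF assms] a7(2) one_minus_deg7_x[OF assms]
    by (simp add: power_divide power_mult_distrib flip: power_mult)
qed

section \<open>Holomorphy in q and the multiplier\<close>

lemma eulerE_holomorphic: "eulerE holomorphic_on ball 0 1"
proof (rule holomorphic_uniform_sequence[where f = "\<lambda>N q. \<Prod>n<N. 1 - q * q ^ n"])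
  fix x :: complex
  assume "x \<in> ball 0 1"
  then have x: "norm x < 1"
    by simp
  define d where "d = (1 - norm x) / 2"
  define r where "r = (1 + norm x) / 2"
  have d: "d > 0" and r: "0 < r" "r < 1"
    using x by (auto simp: d_def r_def intro!: add_pos_nonneg)
  have yr: "norm y \<le> r" if "y \<in> cball x d" for y
  proof -
    have "norm y \<le> norm x + norm (x - y)"
      using norm_triangle_ineq4[of x "x - y"] by simp
    then show ?thesis
      using that unfolding d_def r_def by (simp add: dist_norm field_simps)
  qed
  have "uniformly_convergent_on (cball x d) (\<lambda>N q. \<Prod>n<N. 1 - q * q ^ n)"
  proof (rule uniformly_convergent_on_prod')
    have "uniform_limit (cball x d) (\<lambda>N q. \<Sum>n<N. norm (1 - q * q ^ n - 1)) (\<lambda>q. \<Sum>n. norm (1 - q * q ^ n - 1)) sequentially"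
    proof (rule Weierstrass_m_test)
      fix n and y :: complex
      assume y: "y \<in> cball x d"
      have "norm (1 - y * y ^ n - 1) = norm y * norm y ^ n"
        by (simp add: norm_mult norm_power)
      also have "\<dots> \<le> 1 * r ^ n"
        using yr[OF y] r by (intro mult_mono power_mono) auto
      finally show "norm (norm (1 - y * y ^ n - 1)) \<le> r ^ n"
        by simp
    qed (use r in \<open>auto intro: summable_geometric\<close>)
    then show "uniformly_convergent_on (cball x d) (\<lambda>N q. \<Sum>n<N. norm (1 - q * q ^ n - 1))"
      by (auto simp: uniformly_convergent_on_def)
  qed (auto intro!: continuous_intros)
  then obtain l where l: "uniform_limit (cball x d) (\<lambda>N q. \<Prod>n<N. 1 - q * q ^ n) l sequentially"
    by (auto simp: uniformly_convergent_on_def)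
  have "l y = eulerE y" if "y \<in> cball x d" for y
  proof (rule LIMSEQ_unique)
    show "(\<lambda>N. \<Prod>n<N. 1 - y * y ^ n) \<longlonglongrightarrow> l y"
      by (rule tendsto_uniform_limitI[OF l that])
    show "(\<lambda>N. \<Prod>n<N. 1 - y * y ^ n) \<longlonglongrightarrow> eulerE y"
      using yr[OF that] r by (intro qpochhammer_inf_LIMSEQ) simp
  qed
  then have "uniform_limit (cball x d) (\<lambda>N q. \<Prod>n<N. 1 - q * q ^ n) eulerE sequentially"
    using l by (subst (asm) uniform_limit_cong'[where g = "\<lambda>N q. \<Prod>n<N. 1 - q * q ^ n" and i = eulerE]) auto
  moreover have "cball x d \<subseteq> ball 0 1"
    using yr r by (force simp: subset_iff)
  ultimately show "\<exists>d>0. cball x d \<subseteq> ball 0 1 \<and>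
      uniform_limit (cball x d) (\<lambda>N q. \<Prod>n<N. 1 - q * q ^ n) eulerE sequentially"
    using d by blast
qed (auto intro!: holomorphic_intros)

lemma eulerE_power_holomorphic:
  assumes "k > 0"
  shows "(\<lambda>q. eulerE (q ^ k)) holomorphic_on ball 0 1"
proof -
  have "eulerE \<circ> (\<lambda>q. q ^ k) holomorphic_on ball 0 1"
    using norm_power_less_one[OF _ assms]
    by (intro holomorphic_on_compose_gen[OF _ eulerE_holomorphic] holomorphic_intros) auto
  then show ?thesis
    by (simp add: o_def)
qed

lemma deg7_x_holomorphic: "deg7_x holomorphic_on ball 0 1"
proof -
  have "eulerE (q ^ k) \<noteq> 0" if "q \<in> ball 0 1" "k > 0" for q k
    using that norm_power_less_one[of q k] by (intro eulerE_nonzero) auto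
  then show ?thesis
    unfolding deg7_x_def
    by (intro holomorphic_intros eulerE_power_holomorphic eulerE_holomorphic) auto
qed

text \<open>Differentiating the two product relations expresses the same logarithmic derivative of
  \<open>deg7_x\<close> in two ways.\<close>

lemma deg7_multiplier:
  assumes q: "norm q < 1" "q \<noteq> 0"
  shows "(deg7_x q - modular_alpha q) * ramanujan_phi q ^ 4 =
    7 * (modular_alpha (q ^ 7) - deg7_x q) * ramanujan_phi (q ^ 7) ^ 4"
proof -
  define a b x where "a = modular_alpha q" and "b = modular_alpha (q ^ 7)" and "x = deg7_x q"
  define f g where "f = ramanujan_phi q ^ 4" and "g = ramanujan_phi (q ^ 7) ^ 4"
  have q7: "norm (q ^ 7) < 1" "q ^ 7 \<noteq> 0"
    using norm_power_less_one[OF q(1)] q by simp_all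
  have "deg7_x field_differentiable at q"
    using deg7_x_holomorphic by (rule holomorphic_on_imp_differentiable_at) (use q in auto)
  then obtain x' where dx: "(deg7_x has_field_derivative x') (at q)"
    by (auto simp: field_differentiable_def)
  have da: "(modular_alpha has_field_derivative a * (1 - a) * f / q) (at q)"
    unfolding a_def f_def by (rule modular_alpha_has_deriv[OF q])
  have db: "((\<lambda>q. modular_alpha (q ^ 7)) has_field_derivative 7 * b * (1 - b) * g / q) (at q)"
  proof -
    have "((\<lambda>q. modular_alpha (q ^ 7)) has_field_derivative b * (1 - b) * g / q ^ 7 * (of_nat 7 * q ^ 6)) (at q)"
      unfolding b_def g_def
      by (rule DERIV_chain2[where g = "\<lambda>q. q ^ 7", OF modular_alpha_has_deriv[OF q7]]) (auto intro!: derivative_eq_intros)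
    also have "b * (1 - b) * g / q ^ 7 * (of_nat 7 * q ^ 6) = 7 * b * (1 - b) * g / q"
      using q by (simp add: field_simps eval_nat_numeral)
    finally show ?thesis .
  qed
  have clear: "c * (q * y) = A * u + B * v" if "c * y = A / q * u + B / q * v" for c y A B u v
  proof -
    have "c * (q * y) = q * (A / q * u + B / q * v)"
      unfolding that[symmetric] by (simp only: mult_ac)
    then show ?thesis
      using q by (simp add: distrib_left)
  qed
  have ev: "eventually (\<lambda>q. q \<in> ball 0 1 - {0}) (nhds q)"
    using q by (intro eventually_nhds_in_open) (auto intro: open_delete)
  have ev1: "eventually (\<lambda>q. deg7_x q ^ 8 = modular_alpha q * modular_alpha (q ^ 7)) (nhds q)"
    using ev by eventually_elim (simp add: deg7_alpha_mult(1))
  have ev2: "eventually (\<lambda>q. (1 - deg7_x q) ^ 8 = (1 - modular_alpha q) * (1 - modular_alpha (q ^ 7))) (nhds q)"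
    using ev by eventually_elim (simp add: deg7_alpha_mult(2))
  have "((\<lambda>q. modular_alpha q * modular_alpha (q ^ 7)) has_field_derivative 8 * x ^ 7 * x') (at q)"
    by (rule DERIV_cong_ev[OF refl ev1 refl, THEN iffD1])
       (auto intro!: derivative_eq_intros dx simp: x_def)
  moreover have "((\<lambda>q. modular_alpha q * modular_alpha (q ^ 7)) has_field_derivative
      a * (1 - a) * f / q * b + 7 * b * (1 - b) * g / q * a) (at q)"
    using DERIV_mult'[OF da db] by (simp add: a_def b_def add.commute mult.commute)
  ultimately have "8 * x ^ 7 * x' = a * (1 - a) * f / q * b + 7 * b * (1 - b) * g / q * a"
    by (rule DERIV_unique)
  then have "8 * x ^ 7 * (q * x') = a * (1 - a) * f * b + 7 * b * (1 - b) * g * a"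
    by (rule clear)
  also have "\<dots> = (a * b) * ((1 - a) * f + 7 * (1 - b) * g)"
    by (simp add: algebra_simps)
  also have "a * b = x ^ 7 * x"
    using deg7_alpha_mult(1)[OF q] unfolding a_def b_def x_def by (simp add: eval_nat_numeral)
  finally have 1: "x ^ 7 * (8 * (q * x')) = x ^ 7 * (x * ((1 - a) * f + 7 * (1 - b) * g))"
    by (simp only: mult_ac)
  have "((\<lambda>q. (1 - modular_alpha q) * (1 - modular_alpha (q ^ 7))) has_field_derivative - (8 * (1 - x) ^ 7 * x')) (at q)"
    by (rule DERIV_cong_ev[OF refl ev2 refl, THEN iffD1])
       (auto intro!: derivative_eq_intros dx simp: x_def)
  moreover have "((\<lambda>q. (1 - modular_alpha q) * (1 - modular_alpha (q ^ 7))) has_field_derivative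
      - (a * (1 - a) * f / q * (1 - b) + 7 * b * (1 - b) * g / q * (1 - a))) (at q)"
    by (rule derivative_eq_intros da db refl)+ (simp add: a_def b_def algebra_simps)
  ultimately have "- (8 * (1 - x) ^ 7 * x') = - (a * (1 - a) * f / q * (1 - b) + 7 * b * (1 - b) * g / q * (1 - a))"
    by (rule DERIV_unique)
  then have "8 * (1 - x) ^ 7 * x' = a * (1 - a) * f / q * (1 - b) + 7 * b * (1 - b) * g / q * (1 - a)"
    by (simp only: neg_equal_iff_equal)
  then have "8 * (1 - x) ^ 7 * (q * x') = a * (1 - a) * f * (1 - b) + 7 * b * (1 - b) * g * (1 - a)"
    by (rule clear)
  also have "\<dots> = ((1 - a) * (1 - b)) * (a * f + 7 * b * g)"
    by (simp add: algebra_simps)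
  also have "(1 - a) * (1 - b) = (1 - x) ^ 7 * (1 - x)"
    using deg7_alpha_mult(2)[OF q] unfolding a_def b_def x_def by (simp add: eval_nat_numeral)
  finally have 2: "(1 - x) ^ 7 * (8 * (q * x')) = (1 - x) ^ 7 * ((1 - x) * (a * f + 7 * b * g))"
    by (simp only: mult_ac)
  have nz: "eulerE (q ^ k) \<noteq> 0" if "k > 0" for k
    using eulerE_nonzero norm_power_less_one[OF q(1) that] by blast
  have "x \<noteq> 0" "1 - x \<noteq> 0"
    using nz nz[of 1] q unfolding x_def one_minus_deg7_x[OF q] by (auto simp: deg7_x_def)
  then have "x * ((1 - a) * f + 7 * (1 - b) * g) = (1 - x) * (a * f + 7 * b * g)"
    using 1 2 by simp
  \<comment> \<open>Both sides are 8 q x'. The terms in x a f and x b g occur on either side and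
    cancel.\<close>
  then have "(x - a) * f = 7 * (b - x) * g"
    by (simp add: algebra_simps)
  then show ?thesis
    unfolding a_def b_def x_def f_def g_def .
qed

definition deg7_t :: "complex \<Rightarrow> complex" where
  "deg7_t q = deg7_x q * (1 - deg7_x q)"

text \<open>The quotient (Q / P)^4, in which q^(5/4) contributes q^5 and Q contributes q^(-4); it is
  thus single-valued in q.\<close>

definition deg7_v :: "complex \<Rightarrow> complex" where
  "deg7_v q = q * eulerE (q ^ 7) ^ 4 * eulerE (q ^ 28) ^ 4 * eulerE (q\<^sup>2) ^ 8
    / (eulerE q ^ 4 * eulerE (q ^ 4) ^ 4 * eulerE (q ^ 14) ^ 8)"

definition deg7_m :: "complex \<Rightarrow> complex" where
  "deg7_m q = ramanujan_phi q ^ 4 / ramanujan_phi (q ^ 7) ^ 4"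

text \<open>Pure comparison of Euler quotients. Only the cube of v is matched with beta and t here,
  which is the source of the cubic ambiguity in \<open>degree7_algebra\<close>.\<close>

lemma deg7_v_cube:
  assumes "norm q < 1" "q \<noteq> 0"
  shows "deg7_v q ^ 3 * deg7_t q ^ 4 = modular_alpha (q ^ 7) * (1 - modular_alpha (q ^ 7))"
proof -
  have q7: "norm (q ^ 7) < 1" "q ^ 7 \<noteq> 0"
    using norm_power_less_one[OF assms(1)] assms by simp_all
  have nz: "eulerE (q ^ k) \<noteq> 0" if "k > 0" for k
    using eulerE_nonzero norm_power_less_one[OF assms(1) that] by blast
  note a7 = modular_alpha_eq[OF q7, folded power_mult, simplified]
  have "(q * d ^ 4 * f ^ 4 * b ^ 8 / (a ^ 4 * c ^ 4 * e ^ 8)) ^ 3 *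
      (2 * q * a * c ^ 2 * d * f ^ 2 / (b ^ 3 * e ^ 3) * (a ^ 2 * c * d ^ 2 * f / (b ^ 3 * e ^ 3))) ^ 4 =
      16 * q ^ 7 * d ^ 8 * f ^ 16 / e ^ 24 * (d ^ 16 * f ^ 8 / e ^ 24)"
    if "a \<noteq> 0" "b \<noteq> 0" "c \<noteq> 0" "e \<noteq> 0" for a b c d e f :: complex
    using that by (simp add: power_divide power_mult_distrib divide_simps flip: power_mult power_add)
      (intro disjI2, algebra)
  note * = this[where a = "eulerE q" and b = "eulerE (q\<^sup>2)" and c = "eulerE (q ^ 4)" and
    d = "eulerE (q ^ 7)" and e = "eulerE (q ^ 14)" and f = "eulerE (q ^ 28)"]
  show ?thesis
    unfolding deg7_v_def deg7_t_def one_minus_deg7_x[OF assms] a7(2)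
    unfolding a7(1) deg7_x_def using nz nz[of 1] by (intro *) simp_all
qed

text \<open>Leading terms decide the branch: x and t behave like 2 q, alpha like 16 q, v like q. So
  V = v + 1 / v and s both behave like 1 / q, and V^2 + V s + s^2, of order 3 / q^2, cannot equal
  3.\<close>

lemma deg7_near_zero:
  "eventually (\<lambda>q. deg7_v q + 1 / deg7_v q = 4 * deg7_t q + 2 / deg7_t q - 7 \<and>
     deg7_m q = 1 + 4 * deg7_t q + 8 * deg7_t q * (3 - 2 * deg7_t q) * deg7_v q) (at 0)"
proof -
  have E: "((\<lambda>q. eulerE (q ^ k)) \<longlongrightarrow> 1) (at 0)" if "k > 0" for k
  proof -
    have "continuous_on (ball 0 1) (\<lambda>q. eulerE (q ^ k))"
      by (intro holomorphic_on_imp_continuous_on eulerE_power_holomorphic that)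
    then have "isCont (\<lambda>q. eulerE (q ^ k)) 0"
      by (subst (asm) continuous_on_eq_continuous_at) auto
    moreover have "eulerE (0 ^ k) = 1"
      using that by (simp add: qpochhammer_inf_def zero_power)
    ultimately show ?thesis
      by (simp add: isCont_def)
  qed
  note E1 = E[of 1, simplified]
  define X where "X q = 2 * eulerE q * eulerE (q ^ 4) ^ 2 * eulerE (q ^ 7) * eulerE (q ^ 28) ^ 2
    / (eulerE (q\<^sup>2) ^ 3 * eulerE (q ^ 14) ^ 3)" for q
  define V where "V q = eulerE (q ^ 7) ^ 4 * eulerE (q ^ 28) ^ 4 * eulerE (q\<^sup>2) ^ 8
    / (eulerE q ^ 4 * eulerE (q ^ 4) ^ 4 * eulerE (q ^ 14) ^ 8)" for q
  define A where "A q = 16 * eulerE q ^ 8 * eulerE (q ^ 4) ^ 16 / eulerE (q\<^sup>2) ^ 24" for q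
  define T where "T q = X q * (1 - q * X q)" for q
  have x: "deg7_x q = q * X q" and v: "deg7_v q = q * V q" and t: "deg7_t q = q * T q" for q
    by (simp_all add: deg7_x_def deg7_v_def deg7_t_def X_def V_def T_def mult.assoc)
  have X: "(X \<longlongrightarrow> 2) (at 0)"
    unfolding X_def by (rule tendsto_eq_intros E E1 refl | simp)+
  have V: "(V \<longlongrightarrow> 1) (at 0)"
    unfolding V_def by (rule tendsto_eq_intros E E1 refl | simp)+
  have A: "(A \<longlongrightarrow> 16) (at 0)"
    unfolding A_def by (rule tendsto_eq_intros E E1 refl | simp)+
  have T: "(T \<longlongrightarrow> 2) (at 0)"
    unfolding T_def by (rule tendsto_eq_intros X refl | simp)+
  \<comment> \<open>\<open>VV\<close> and \<open>S\<close> are q (v + 1 / v) and q s, rescaled so as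
    to have finite limits at 0.\<close>
  define VV where "VV q = q * (q * V q) + 1 / V q" for q
  define S where "S q = 4 * q * (q * T q) + 2 / T q - 7 * q" for q
  have VV: "(VV \<longlongrightarrow> 1) (at 0)"
    unfolding VV_def by (rule tendsto_eq_intros V refl | simp)+
  have S: "(S \<longlongrightarrow> 1) (at 0)"
    unfolding S_def by (rule tendsto_eq_intros T refl | simp)+
  have l1: "((\<lambda>q. X q - A q) \<longlongrightarrow> 2 - 16) (at 0)"
    by (intro tendsto_intros X A)
  have l2: "((\<lambda>q. VV q ^ 2 + VV q * S q + S q ^ 2 - 3 * q ^ 2) \<longlongrightarrow> 1 ^ 2 + 1 * 1 + 1 ^ 2 - 3 * 0 ^ 2) (at 0)"
    by (intro tendsto_intros VV S)
  have l3: "((\<lambda>q. S q ^ 2 - q ^ 2) \<longlongrightarrow> 1 ^ 2 - 0 ^ 2) (at 0)"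
    by (intro tendsto_intros S)
  have ev: "eventually (\<lambda>q. q \<in> ball 0 1 - {0}) (at (0 :: complex))"
    using eventually_at_ball'[of 1 "0 :: complex" UNIV] by (auto elim: eventually_mono)
  have "eventually (\<lambda>q. T q \<noteq> 0) (at 0)"
    by (rule tendsto_imp_eventually_ne[OF T]) simp
  moreover have "eventually (\<lambda>q. V q \<noteq> 0) (at 0)"
    by (rule tendsto_imp_eventually_ne[OF V]) simp
  moreover have "eventually (\<lambda>q. X q - A q \<noteq> 0) (at 0)"
    by (rule tendsto_imp_eventually_ne[OF l1]) simp
  moreover have "eventually (\<lambda>q. VV q ^ 2 + VV q * S q + S q ^ 2 - 3 * q ^ 2 \<noteq> 0) (at 0)"
    by (rule tendsto_imp_eventually_ne[OF l2]) simp
  moreover have "eventually (\<lambda>q. S q ^ 2 - q ^ 2 \<noteq> 0) (at 0)"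
    by (rule tendsto_imp_eventually_ne[OF l3]) simp
  ultimately show ?thesis
    using ev
  proof eventually_elim
    case (elim q)
    then have q: "norm q < 1" "q \<noteq> 0" and nz: "T q \<noteq> 0" "V q \<noteq> 0" "X q \<noteq> A q"
      "VV q ^ 2 + VV q * S q + S q ^ 2 - 3 * q ^ 2 \<noteq> 0" "S q ^ 2 - q ^ 2 \<noteq> 0"
      by auto
    have q7: "norm (q ^ 7) < 1" "q ^ 7 \<noteq> 0"
      using norm_power_less_one[OF q(1)] q by simp_all
    let ?x = "deg7_x q" and ?a = "modular_alpha q" and ?b = "modular_alpha (q ^ 7)" and ?v = "deg7_v q"
    let ?t = "?x * (1 - ?x)"
    let ?s = "4 * ?t + 2 / ?t - 7"
    have t': "?t = q * T q"
      using t[of q] by (simp add: deg7_t_def)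
    have a: "?a = q * A q"
      using modular_alpha_eq(1)[OF q] by (simp add: A_def mult.assoc)
    have qV: "q * (?v + 1 / ?v) = VV q"
      unfolding v VV_def using q nz by (simp add: field_simps)
    have qS: "q * ?s = S q"
      unfolding t' S_def using q nz by (simp add: field_simps)
    have m: "(?x - ?a) * deg7_m q = 7 * (?b - ?x)"
      using deg7_multiplier[OF q] phi_nonzero[OF q7] by (simp add: deg7_m_def field_simps)
    have hom: "(q * u)\<^sup>2 + q * u * (q * w) + (q * w)\<^sup>2 = q\<^sup>2 * (u\<^sup>2 + u * w + w\<^sup>2)" for u w
      by (simp add: power2_eq_square algebra_simps)
    have nz4: "(?v + 1 / ?v)\<^sup>2 + (?v + 1 / ?v) * ?s + ?s\<^sup>2 \<noteq> 3"
    proof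
      assume *: "(?v + 1 / ?v)\<^sup>2 + (?v + 1 / ?v) * ?s + ?s\<^sup>2 = 3"
      have "VV q ^ 2 + VV q * S q + S q ^ 2 = q\<^sup>2 * ((?v + 1 / ?v)\<^sup>2 + (?v + 1 / ?v) * ?s + ?s\<^sup>2)"
        unfolding qV[symmetric] qS[symmetric] by (rule hom)
      then show False
        unfolding * using nz(4) by simp
    qed
    have nz5: "?s\<^sup>2 \<noteq> 1"
    proof
      assume *: "?s\<^sup>2 = 1"
      have "S q ^ 2 = q\<^sup>2 * ?s\<^sup>2"
        unfolding qS[symmetric] by (simp only: power_mult_distrib)
      then show False
        unfolding * using nz(5) by simp
    qed
    have nzs: "?t \<noteq> 0" "?v \<noteq> 0" "?x \<noteq> ?a"
      unfolding t' unfolding v x a using q nz by auto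
    note * = degree7_algebra[OF deg7_alpha_mult[OF q] deg7_v_cube[OF q, unfolded deg7_t_def] m nzs nz4 nz5]
    show ?case
      using * unfolding deg7_t_def by blast
  qed
qed


text \<open>The fractional power enters only as some r with r^4 = q^5. With w = P / Q the Euler
  quotients give w^8 m = Q^2, whence P Q = w Q^2 = w^9 m.\<close>

lemma theorem3p3_of_deg7:
  fixes q r P Q X A :: complex
  assumes q: "norm q < 1" "q \<noteq> 0" and r: "r ^ 4 = q ^ 5"
    and vt: "deg7_v q + 1 / deg7_v q = 4 * deg7_t q + 2 / deg7_t q - 7"
    and m: "deg7_m q = 1 + 4 * deg7_t q + 8 * deg7_t q * (3 - 2 * deg7_t q) * deg7_v q"
    and P: "P = eulerE q * eulerE (q ^ 4) / (r * eulerE (q ^ 7) * eulerE (q ^ 28))"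
    and Q: "Q = eulerE (q\<^sup>2) ^ 2 / (q * eulerE (q ^ 14) ^ 2)"
    and X: "X = (P / Q) ^ 2 + (Q / P) ^ 2"
    and A: "A = (P * Q) ^ 2 + (49 / (P * Q)) ^ 2"
  shows "A ^ 2 = A * (X ^ 9 + 7 * X ^ 7 - 37 * X ^ 5 - 77 * X ^ 3 + 294 * X)
           - X ^ 12 - 20 * X ^ 10 - 86 * X ^ 8 - 2065 * X ^ 6 + 16317 * X ^ 4 - 22981 * X ^ 2"
proof -
  have q7: "norm (q ^ 7) < 1" "q ^ 7 \<noteq> 0"
    using norm_power_less_one[OF q(1)] q by simp_all
  define a b c d e f where abc: "a = eulerE q" "b = eulerE (q\<^sup>2)" "c = eulerE (q ^ 4)"
    "d = eulerE (q ^ 7)" "e = eulerE (q ^ 14)" "f = eulerE (q ^ 28)"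
  have nz: "a \<noteq> 0" "b \<noteq> 0" "c \<noteq> 0" "d \<noteq> 0" "e \<noteq> 0" "f \<noteq> 0"
    unfolding abc using eulerE_nonzero norm_power_less_one[OF q(1)] q(1) by simp_all
  have r0: "r \<noteq> 0"
    using r q by auto
  define w where "w = P / Q"
  have w: "w = q * a * c * e\<^sup>2 / (r * d * f * b\<^sup>2)"
    unfolding w_def P Q abc[symmetric] using nz q r0 by (simp add: field_simps)
  have w0: "w \<noteq> 0"
    unfolding w using nz q r0 by simp
  have v: "deg7_v q = 1 / w ^ 4"
    unfolding w deg7_v_def abc[symmetric] power_divide power_mult_distrib r using nz q
    by (simp add: field_simps flip: power_mult) (simp add: eval_nat_numeral)
  have "deg7_m q = b ^ 20 * d ^ 8 * f ^ 8 / (a ^ 8 * c ^ 8 * e ^ 20)"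
    using nz modular_alpha_eq(3)[OF q] modular_alpha_eq(3)[OF q7, folded power_mult, simplified]
    unfolding deg7_m_def abc[symmetric] by simp
  moreover have "w ^ 8 = a ^ 8 * c ^ 8 * e ^ 16 / (q\<^sup>2 * d ^ 8 * f ^ 8 * b ^ 16)"
  proof -
    have "r ^ 8 = q ^ 10"
      using arg_cong[OF r, of "\<lambda>x. x\<^sup>2"] by (simp flip: power_mult)
    moreover have "q ^ 8 / q ^ 10 = 1 / q\<^sup>2"
      using q by (simp add: eval_nat_numeral)
    ultimately show ?thesis
      unfolding w power_divide power_mult_distrib using q
      by (simp add: divide_simps flip: power_mult)
  qed
  moreover have "P * Q = w * Q\<^sup>2"
    using nz q unfolding w_def Q abc[symmetric] by (simp add: power2_eq_square)
  ultimately have PQ: "P * Q = w ^ 9 * deg7_m q"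
  proof -
    assume mm: "deg7_m q = b ^ 20 * d ^ 8 * f ^ 8 / (a ^ 8 * c ^ 8 * e ^ 20)"
      and w8: "w ^ 8 = a ^ 8 * c ^ 8 * e ^ 16 / (q\<^sup>2 * d ^ 8 * f ^ 8 * b ^ 16)"
      and pq: "P * Q = w * Q\<^sup>2"
    have "w ^ 8 * deg7_m q = Q\<^sup>2"
      unfolding mm w8 Q abc[symmetric] using nz q
      by (simp add: power_divide power_mult_distrib divide_simps flip: power_mult power_add)
    moreover have "w ^ 9 = w * w ^ 8"
      by (simp flip: power_Suc)
    ultimately show ?thesis
      unfolding pq by (simp add: mult.assoc)
  qed
  have t0: "deg7_t q \<noteq> 0"
    using one_minus_deg7_x[OF q] nz q unfolding deg7_t_def deg7_x_def abc[symmetric] by simp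
  show ?thesis
  proof (rule theorem3p3_algebra[OF w0 t0])
    show "1 / w ^ 4 + 1 / (1 / w ^ 4) = 4 * deg7_t q + 2 / deg7_t q - 7"
      using vt unfolding v .
    show "P * Q = w ^ 9 * (1 + 4 * deg7_t q + 8 * deg7_t q * (3 - 2 * deg7_t q) * (1 / w ^ 4))"
      using PQ unfolding m v .
    show "X = w\<^sup>2 + (1 / w)\<^sup>2"
      unfolding X w_def by simp
  qed (rule A)
qed

section \<open>Analytic continuation over the upper half-plane\<close>

theorem theorem3p3:
  fixes \<tau> q P Q X A :: complex
  assumes "Im \<tau> > 0"
    and "q = exp (2 * of_real pi * \<i> * \<tau>)"
    and "P = ramanujan_f (- q) * ramanujan_f (- (q ^ 4)) /
             (nome_power \<tau> (5/4) * ramanujan_f (- (q ^ 7)) * ramanujan_f (- (q ^ 28)))"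
    and "Q = ramanujan_f (- (q ^ 2)) ^ 2 / (q * ramanujan_f (- (q ^ 14)) ^ 2)"
    and "X = (P / Q) ^ 2 + (Q / P) ^ 2"
    and "A = (P * Q) ^ 2 + (49 / (P * Q)) ^ 2"
  shows "A ^ 2 = A * (X ^ 9 + 7 * X ^ 7 - 37 * X ^ 5 - 77 * X ^ 3 + 294 * X)
           - X ^ 12 - 20 * X ^ 10 - 86 * X ^ 8 - 2065 * X ^ 6 + 16317 * X ^ 4 - 22981 * X ^ 2"
proof -
  define H where "H = {\<tau>. Im \<tau> > 0}"
  define q' where "q' \<tau> = exp (2 * of_real pi * \<i> * \<tau>)" for \<tau>
  define P' where "P' \<tau> = eulerE (q' \<tau>) * eulerE (q' \<tau> ^ 4) /
    (nome_power \<tau> (5/4) * eulerE (q' \<tau> ^ 7) * eulerE (q' \<tau> ^ 28))" for \<tau>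
  define Q' where "Q' \<tau> = eulerE (q' \<tau> ^ 2) ^ 2 / (q' \<tau> * eulerE (q' \<tau> ^ 14) ^ 2)" for \<tau>
  define X' where "X' \<tau> = (P' \<tau> / Q' \<tau>) ^ 2 + (Q' \<tau> / P' \<tau>) ^ 2" for \<tau>
  define A' where "A' \<tau> = (P' \<tau> * Q' \<tau>) ^ 2 + (49 / (P' \<tau> * Q' \<tau>)) ^ 2" for \<tau>
  define R where "R \<tau> = A' \<tau> * (X' \<tau> ^ 9 + 7 * X' \<tau> ^ 7 - 37 * X' \<tau> ^ 5 - 77 * X' \<tau> ^ 3 + 294 * X' \<tau>)
           - X' \<tau> ^ 12 - 20 * X' \<tau> ^ 10 - 86 * X' \<tau> ^ 8 - 2065 * X' \<tau> ^ 6 + 16317 * X' \<tau> ^ 4 - 22981 * X' \<tau> ^ 2" for \<tau>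
  have norm_q: "norm (q' \<tau>) = exp (- (2 * pi * Im \<tau>))" for \<tau>
    by (simp add: q'_def)
  have q_lt: "norm (q' \<tau>) < 1" if "\<tau> \<in> H" for \<tau>
    using that unfolding norm_q H_def by simp
  have q_nz: "q' \<tau> \<noteq> 0" for \<tau>
    by (simp add: q'_def)
  have E_nz: "eulerE (q' \<tau> ^ k) \<noteq> 0" if "\<tau> \<in> H" "k > 0" for \<tau> k
    using eulerE_nonzero norm_power_less_one[OF q_lt[OF that(1)] that(2)] by blast
  have E_nz1: "eulerE (q' \<tau>) \<noteq> 0" if "\<tau> \<in> H" for \<tau>
    using E_nz[OF that, of 1] by simp
  have q_hol: "q' holomorphic_on H"
    unfolding q'_def by (intro holomorphic_intros)
  have E_hol: "(\<lambda>\<tau>. eulerE (q' \<tau> ^ k)) holomorphic_on H" if "k > 0" for k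
  proof -
    have "q' ` H \<subseteq> ball 0 1"
      using q_lt by auto
    then show ?thesis
      using holomorphic_on_compose_gen[OF q_hol eulerE_power_holomorphic[OF that]] by (simp add: o_def)
  qed
  have E_hol1: "(\<lambda>\<tau>. eulerE (q' \<tau>)) holomorphic_on H"
    using E_hol[of 1] by simp
  have nome_nz: "nome_power \<tau> s \<noteq> 0" for \<tau> s
    by (simp add: nome_power_def)
  have nome_hol: "(\<lambda>\<tau>. nome_power \<tau> s) holomorphic_on H" for s
    unfolding nome_power_def by (intro holomorphic_intros)
  have P_nz: "P' \<tau> \<noteq> 0" and Q_nz: "Q' \<tau> \<noteq> 0" if "\<tau> \<in> H" for \<tau>
    using E_nz[OF that] E_nz1[OF that] q_nz nome_nz by (simp_all add: P'_def Q'_def)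
  have P_hol: "P' holomorphic_on H"
    unfolding P'_def using E_nz E_nz1 nome_nz
    by (intro holomorphic_intros E_hol E_hol1 nome_hol) auto
  have Q_hol: "Q' holomorphic_on H"
    unfolding Q'_def using E_nz E_nz1 q_nz
    by (intro holomorphic_intros E_hol E_hol1 q_hol) auto
  have X_hol: "X' holomorphic_on H"
    unfolding X'_def using P_nz Q_nz by (intro holomorphic_intros P_hol Q_hol) auto
  have A_hol: "A' holomorphic_on H"
    unfolding A'_def using P_nz Q_nz by (intro holomorphic_intros P_hol Q_hol) auto
  have R_hol: "R holomorphic_on H"
    unfolding R_def by (intro holomorphic_intros X_hol A_hol)
  obtain \<delta> where \<delta>: "\<delta> > 0" and near: "\<And>q. q \<noteq> 0 \<Longrightarrow> norm q < \<delta> \<Longrightarrow>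
      deg7_v q + 1 / deg7_v q = 4 * deg7_t q + 2 / deg7_t q - 7 \<and>
      deg7_m q = 1 + 4 * deg7_t q + 8 * deg7_t q * (3 - 2 * deg7_t q) * deg7_v q"
    using deg7_near_zero unfolding eventually_at by (auto simp: dist_norm)
  \<comment> \<open>As |q| = exp (- 2 pi Im \<tau>), the bound Im \<tau> > - ln \<delta> / (2 pi)
    means |q| < \<delta>; the maximum with 0 keeps the half-plane inside \<open>H\<close>.\<close>
  define C where "C = max 0 (- ln \<delta> / (2 * pi))"
  \<comment> \<open>The continuation runs in \<tau> because P' contains \<open>nome_power\<close>,
    which is not a function of q. Both sides are holomorphic on the connected set \<open>H\<close>,
    where P' and Q' have no zeros.\<close>
  have "A' \<tau> ^ 2 = R \<tau>"
  proof (rule analytic_continuation_open[where s = "{\<tau>. Im \<tau> > C}" and s' = H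
        and f = "\<lambda>\<tau>. A' \<tau> ^ 2" and g = R])
    show "{\<tau>. Im \<tau> > C} \<noteq> {}"
      by (rule ex_in_conv[THEN iffD1], rule exI[of _ "Complex 0 (C + 1)"]) simp
    show "connected H"
      unfolding H_def by (intro convex_connected convex_halfspace_Im_gt)
    show "{\<tau>. Im \<tau> > C} \<subseteq> H"
      unfolding H_def C_def by auto
    show "open {\<tau>. Im \<tau> > C}" "open H"
      unfolding H_def by (rule open_halfspace_Im_gt)+
    show "(\<lambda>\<tau>. A' \<tau> ^ 2) holomorphic_on H"
      by (intro holomorphic_intros A_hol)
    show "R holomorphic_on H"
      by (rule R_hol)
    show "\<tau> \<in> H"
      using assms(1) by (simp add: H_def)
    fix \<tau> assume "\<tau> \<in> {\<tau>. Im \<tau> > C}"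
    then have H: "\<tau> \<in> H" and gt: "- ln \<delta> / (2 * pi) < Im \<tau>"
      unfolding H_def C_def by auto
    have "- (2 * pi * Im \<tau>) < ln \<delta>"
      using gt by (simp add: field_simps)
    then have "norm (q' \<tau>) < exp (ln \<delta>)"
      unfolding norm_q by (subst exp_less_cancel_iff)
    then have lt: "norm (q' \<tau>) < \<delta>"
      using \<delta> by simp
    have nome: "nome_power \<tau> (5/4) ^ 4 = q' \<tau> ^ 5"
      unfolding nome_power_def q'_def exp_of_nat_mult[symmetric] by (simp add: mult_ac)
    show "A' \<tau> ^ 2 = R \<tau>"
      unfolding R_def
      by (rule theorem3p3_of_deg7[OF q_lt[OF H] q_nz nome near[OF q_nz lt, THEN conjunct1]
            near[OF q_nz lt, THEN conjunct2] P'_def Q'_def X'_def A'_def])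
  qed
  moreover have "P' \<tau> = P" "Q' \<tau> = Q"
    unfolding P'_def Q'_def assms(3,4) unfolding assms(2) q'_def ramanujan_f_def by simp_all
  moreover from this have "X' \<tau> = X" "A' \<tau> = A"
    unfolding X'_def A'_def assms(5,6) by simp_all
  ultimately show ?thesis
    unfolding R_def by simp
qed

end
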